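(* Let the Bayesian model specified by $P[X|\Theta]$ and $P^{\theta}[\Theta|Y]$ be conjugate, with posterior index $(T^{(n)})_n$. Let $\tilde P[\tilde X|\tilde\Theta]$ and $\tilde P^{\theta}[\tilde\Theta|\tilde Y]$ be the respective pullbacks under $\mathcal{J}_{\mathcal{X}}:\tilde{\mathcal{X}}\to\mathcal{X}$ and $\mathcal{J}_{\mathcal{T}}:\tilde{\mathcal{T}}\to\mathcal{T}$. Then the Bayesian model specified by $\tilde P[\tilde X|\tilde\Theta]$ and $\tilde P^{\theta}[\tilde\Theta|\tilde Y]$ is conjugate, with posterior index given by the pullbacks of $(T^{(n)})_n$ as $$\tilde T^{(n)}:=\mathcal{J}_{\mathcal{Y}}^{-1}\circ T^{(n)}\circ(\mathcal{J}_{\mathcal{X}}^n\otimes\mathcal{J}_{\mathcal{Y}}),$$ where $\mathcal{J}_{\mathcal{Y}}:\tilde{\mathcal{Y}}\to\mathcal{Y}$ is the inclusion of the restricted hyperparameter space.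
   Context: $(\Omega,\mathcal{A},\mathbb{P})$ is an abstract probability space, the common domain of all random variables; $\mathcal{X},\mathcal{T},\mathcal{Y}$ are Polish (standard Borel) spaces. Bayesian model: a parametrized model $P[X|\Theta]$ (regular conditional probability of the $\mathcal{X}$-valued observation $X$ given the $\mathcal{T}$-valued parameter $\Theta$; observations $X^{(1)},X^{(2)},\dots$ exchangeable, $\Theta=\Psi\circ F\circ X^\infty$ a bimeasurable function $\Psi$ of the limiting empirical measure $F(X^\infty)$), together with a prior family $P^{\theta}[\Theta|Y]$, the regular conditional probability of $\Theta$ given a $\mathcal{Y}$-valued hyperparameter $Y$. Posterior index: a family $(T^{(n)})_n$ of measurable mappings $T^{(n)}:\mathcal{X}^n\times\mathcal{Y}\to\mathcal{W}$ into a Polish space for which there is a probability kernel $k:\mathcal{B}(\mathcal{T})\times\mathcal{W}\to[0,1]$ with $P^{\theta}[A|X^n=(x_1,\dots,x_n),Y=y]=_{\text{a.e.}}k(A,T^{(n)}(x_1,\dots,x_n,y))$ for every $A\in\mathcal{B}(\mathcal{T})$. The model is conjugate with posterior index $(T^{(n)})_n$ if $\mathcal{W}\subset\mathcal{Y}$ and $k(A,y')=P^{\theta}[A|Y=y']$ for all $y'\in\mathcal{Y}$. Pullbacks: if $\nu$ is a measure on $(\mathcal{X},\mathcal{B})$ and $\mathcal{J}:\tilde{\mathcal{X}}\to\mathcal{X}$ satisfies $\nu^{*}(\mathcal{J}(\tilde{\mathcal{X}}))=\nu(\mathcal{X})$ ($\nu^*$ the outer measure), the pullback of $\nu$ is the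 unique measure $\tilde\nu$ on $\mathcal{J}^{-1}\mathcal{B}$ with $\tilde\nu\circ\mathcal{J}^{-1}=\nu$. For the Bayesian model, $\mathcal{J}_{\mathcal{X}}:\tilde{\mathcal{X}}\to\mathcal{X}$ is a Borel embedding (a Borel isomorphism onto its image with the trace $\sigma$-algebra). $\tilde{\mathcal{T}}\subset\mathcal{T}$ is the set of $\theta$ with $P^{*}[\mathcal{J}_{\mathcal{X}}(\tilde{\mathcal{X}})|\Theta=\theta]=1$, $\mathcal{J}_{\mathcal{T}}$ its inclusion map, and $\tilde P[\,\cdot\,|\tilde\Theta=\theta]$ is the pullback of $P[\,\cdot\,|\Theta=\theta]$ under $\mathcal{J}_{\mathcal{X}}$, for $\theta\in\tilde{\mathcal{T}}$. $\tilde{\mathcal{Y}}\subset\mathcal{Y}$ is the set of $y$ with $P^{\theta,*}[\mathcal{J}_{\mathcal{T}}(\tilde{\mathcal{T}})|Y=y]=1$, $\mathcal{J}_{\mathcal{Y}}$ its inclusion map, and $\tilde P^{\theta}[\,\cdot\,|\tilde Y=y]$ is the pullback of $P^{\theta}[\,\cdot\,|Y=y]$ under $\mathcal{J}_{\mathcal{T}}$, for $y\in\tilde{\mathcal{Y}}$. $\tilde X=\mathcal{J}_{\mathcal{X}}^{-1}\circ X$, $\tilde\Theta$, $\tilde Y$ are the corresponding restrictions of the variables to the part $\tilde\Omega\subset\Omega$ of the abstract probability space on which they are defined; $\tilde\Omega$ is assumed measurable and non-null and carries $\tilde{\mathbb{P}}=\mathbb{P}[\,\cdot\,|\tilde\O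mega]$.
   Formalization: If the image of the embedding of X̃ is not Borel, it is assumed that the pullbacks do form a Bayesian model of the restricted variables under P[·|Ω̃], with T̃ and Ỹ Borel; otherwise the claim can fail, as conditioning on Ω̃ may reweight the prior. For Borel images this is proved. *)

theory Defs
  imports "HOL-Probability.Probability"
begin

section \<open>Standard Borel spaces, embeddings, pullbacks\<close>

text \<open>
  Polish ground spaces are types of class \<^class>\<open>polish_space\<close>.  A subset with its trace
  sigma-algebra is standard Borel exactly if it is a Borel set.
\<close>

definition standard_borel :: "'a::polish_space measure \<Rightarrow> bool" where
  "standard_borel N \<longleftrightarrow> (\<exists>S\<in>sets borel. sets N = sets (restrict_space borel S))"

definition borel_embedding :: "'z measure \<Rightarrow> 'x measure \<Rightarrow> ('z \<Rightarrow> 'x) \<Rightarrow> bool" where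
  "borel_embedding Xt N J \<longleftrightarrow>
     inj_on J (space Xt) \<and>
     J \<in> Xt \<rightarrow>\<^sub>M restrict_space N (J ` space Xt) \<and>
     inv_into (space Xt) J \<in> restrict_space N (J ` space Xt) \<rightarrow>\<^sub>M Xt"

text \<open>
  \<open>is_pullback Z J \<nu> \<nu>t\<close>: \<open>\<nu>t\<close> is the measure on the sigma-algebra \<open>J\<^sup>-\<^sup>1 \<B>\<close> of the set \<open>Z\<close> whose
  image under \<open>J\<close> is \<open>\<nu>\<close>.  It is unique, and it exists whenever \<open>J ` Z\<close> has full outer measure.
\<close>

definition is_pullback :: "'z set \<Rightarrow> ('z \<Rightarrow> 'x) \<Rightarrow> 'x measure \<Rightarrow> 'z measure \<Rightarrow> bool" where
  "is_pullback Z J \<nu> \<nu>t \<longleftrightarrow>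
     J ` Z \<subseteq> space \<nu> \<and> sets \<nu>t = sets (vimage_algebra Z J \<nu>) \<and> distr \<nu>t \<nu> J = \<nu>"

section \<open>Conditional probabilities\<close>

text \<open>A version of the conditional probability of the event \<open>E\<close> given the variable \<open>V\<close>, as a random variable.\<close>

definition event_prob_given ::
  "'w measure \<Rightarrow> 'b measure \<Rightarrow> ('w \<Rightarrow> 'b) \<Rightarrow> 'w set \<Rightarrow> 'w \<Rightarrow> real" where
  "event_prob_given M N V E = real_cond_exp M (vimage_algebra (space M) V N) (indicator E)"

definition regular_conditional ::
  "'w measure \<Rightarrow> 'a measure \<Rightarrow> 'b measure \<Rightarrow> ('w \<Rightarrow> 'a) \<Rightarrow> ('w \<Rightarrow> 'b) \<Rightarrow> ('b \<Rightarrow> 'a measure) \<Rightarrow> bool" where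
  "regular_conditional M A N U V \<kappa> \<longleftrightarrow>
     U \<in> M \<rightarrow>\<^sub>M A \<and> V \<in> M \<rightarrow>\<^sub>M N \<and> \<kappa> \<in> N \<rightarrow>\<^sub>M prob_algebra A \<and>
     (\<forall>S\<in>sets A. AE \<omega> in M. event_prob_given M N V (U -` S) \<omega> = measure (\<kappa> (V \<omega>)) S)"

section \<open>Bayesian models\<close>

abbreviation sample :: "nat \<Rightarrow> (nat \<Rightarrow> 'w \<Rightarrow> 'x) \<Rightarrow> 'w \<Rightarrow> nat \<Rightarrow> 'x" where
  "sample n X \<omega> \<equiv> (\<lambda>i\<in>{..<n}. X i \<omega>)"

abbreviation sample_space :: "nat \<Rightarrow> 'x measure \<Rightarrow> (nat \<Rightarrow> 'x) measure" where
  "sample_space n MX \<equiv> PiM {..<n} (\<lambda>_. MX)"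

definition exchangeable :: "'w measure \<Rightarrow> 'x measure \<Rightarrow> (nat \<Rightarrow> 'w \<Rightarrow> 'x) \<Rightarrow> bool" where
  "exchangeable M MX X \<longleftrightarrow>
     (\<forall>n \<pi>. \<pi> permutes {..<n} \<longrightarrow>
        distr M (sample_space n MX) (sample n (X \<circ> \<pi>)) = distr M (sample_space n MX) (sample n X))"

text \<open>
  Conditionally on \<open>(\<Theta>, Y)\<close> the observations are i.i.d. with law \<open>p \<Theta>\<close>.  For a constant hyperparameter
  and a parameter that determines the limiting empirical measure this is de Finetti's theorem; in
  general it also says that the hyperparameter acts on the observations only through the parameter.
\<close>

definition conditionally_iid ::
  "'w measure \<Rightarrow> 'x measure \<Rightarrow> 't measure \<Rightarrow> 'y measure \<Rightarrow>
     (nat \<Rightarrow> 'w \<Rightarrow> 'x) \<Rightarrow> ('w \<Rightarrow> 't) \<Rightarrow> ('w \<Rightarrow> 'y) \<Rightarrow> ('t \<Rightarrow> 'x measure) \<Rightarrow> bool" where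
  "conditionally_iid M MX MT MY X \<Theta> Y p \<longleftrightarrow>
     (\<forall>n B. (\<forall>i<n. B i \<in> sets MX) \<longrightarrow>
        (AE \<omega> in M. event_prob_given M (MT \<Otimes>\<^sub>M MY) (\<lambda>\<omega>. (\<Theta> \<omega>, Y \<omega>)) {\<omega>. \<forall>i<n. X i \<omega> \<in> B i} \<omega>
                     = (\<Prod>i<n. measure (p (\<Theta> \<omega>)) (B i))))"

text \<open>
  \<open>F\<close> maps a sequence of observations to its limiting empirical measure.  The convergence is almost
  sure for each measurable set, which determines \<open>F\<close> almost surely on a countably generated space and
  needs no topology on the observation space.
\<close>

definition limiting_empirical ::
  "'w measure \<Rightarrow> 'x measure \<Rightarrow> (nat \<Rightarrow> 'w \<Rightarrow> 'x) \<Rightarrow> ((nat \<Rightarrow> 'x) \<Rightarrow> 'x measure) \<Rightarrow> bool" where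
  "limiting_empirical M MX X F \<longleftrightarrow>
     F \<in> PiM UNIV (\<lambda>_. MX) \<rightarrow>\<^sub>M prob_algebra MX \<and>
     (\<forall>B\<in>sets MX. AE \<omega> in M.
        (\<lambda>n. (\<Sum>i<n. indicator B (X i \<omega>)) / real n) \<longlonglongrightarrow> measure (F (\<lambda>i. X i \<omega>)) B)"

definition bimeasurable :: "'a measure \<Rightarrow> 'b measure \<Rightarrow> ('a \<Rightarrow> 'b) \<Rightarrow> bool" where
  "bimeasurable N N' \<Psi> \<longleftrightarrow> \<Psi> \<in> N \<rightarrow>\<^sub>M N' \<and> (\<forall>E\<in>sets N. \<Psi> ` E \<in> sets N')"

text \<open>
  The Bayesian model specified by \<open>p = P[X|\<Theta>]\<close> and \<open>q = P[\<Theta>|Y]\<close>.  No Polishness is required of the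
  observation space, so that models restricted to a non-measurable set of observations are included.
\<close>

definition bayesian_model ::
  "'w measure \<Rightarrow> 'x measure \<Rightarrow> 't::polish_space measure \<Rightarrow> 'y::polish_space measure \<Rightarrow>
     (nat \<Rightarrow> 'w \<Rightarrow> 'x) \<Rightarrow> ('w \<Rightarrow> 't) \<Rightarrow> ('w \<Rightarrow> 'y) \<Rightarrow>
     ('t \<Rightarrow> 'x measure) \<Rightarrow> ('y \<Rightarrow> 't measure) \<Rightarrow> bool" where
  "bayesian_model M MX MT MY X \<Theta> Y p q \<longleftrightarrow>
     prob_space M \<and> standard_borel MT \<and> standard_borel MY \<and>
     (\<forall>i. regular_conditional M MX MT (X i) \<Theta> p) \<and>
     exchangeable M MX X \<and>
     conditionally_iid M MX MT MY X \<Theta> Y p \<and>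
     (\<exists>F \<Psi>. limiting_empirical M MX X F \<and> bimeasurable (prob_algebra MX) MT \<Psi> \<and>
            (AE \<omega> in M. \<Theta> \<omega> = \<Psi> (F (\<lambda>i. X i \<omega>)))) \<and>
     regular_conditional M MT MY \<Theta> Y q"

section \<open>Posterior indices and conjugacy\<close>

definition posterior_index ::
  "'w measure \<Rightarrow> 'x measure \<Rightarrow> 't measure \<Rightarrow> 'y measure \<Rightarrow>
     (nat \<Rightarrow> 'w \<Rightarrow> 'x) \<Rightarrow> ('w \<Rightarrow> 't) \<Rightarrow> ('w \<Rightarrow> 'y) \<Rightarrow>
     'v::polish_space measure \<Rightarrow> ('v \<Rightarrow> 't measure) \<Rightarrow> (nat \<Rightarrow> (nat \<Rightarrow> 'x) \<times> 'y \<Rightarrow> 'v) \<Rightarrow> bool" where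
  "posterior_index M MX MT MY X \<Theta> Y W k T \<longleftrightarrow>
     standard_borel W \<and> k \<in> W \<rightarrow>\<^sub>M prob_algebra MT \<and>
     (\<forall>n\<ge>1. T n \<in> sample_space n MX \<Otimes>\<^sub>M MY \<rightarrow>\<^sub>M W \<and>
        (\<forall>A\<in>sets MT. AE \<omega> in M.
           event_prob_given M (sample_space n MX \<Otimes>\<^sub>M MY) (\<lambda>\<omega>. (sample n X \<omega>, Y \<omega>)) (\<Theta> -` A) \<omega>
             = measure (k (T n (sample n X \<omega>, Y \<omega>))) A))"

definition conjugate ::
  "'w measure \<Rightarrow> 'x measure \<Rightarrow> 't measure \<Rightarrow> 'y::polish_space measure \<Rightarrow>
     (nat \<Rightarrow> 'w \<Rightarrow> 'x) \<Rightarrow> ('w \<Rightarrow> 't) \<Rightarrow> ('w \<Rightarrow> 'y) \<Rightarrow>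
     ('y \<Rightarrow> 't measure) \<Rightarrow> (nat \<Rightarrow> (nat \<Rightarrow> 'x) \<times> 'y \<Rightarrow> 'y) \<Rightarrow> bool" where
  "conjugate M MX MT MY X \<Theta> Y q T \<longleftrightarrow>
     (\<exists>W k. space W \<subseteq> space MY \<and> sets W = sets (restrict_space MY (space W)) \<and>
            posterior_index M MX MT MY X \<Theta> Y W k T \<and> (\<forall>w\<in>space W. k w = q w))"

section \<open>Restriction of a Bayesian model\<close>

text \<open>The set of conditioning values for which \<open>S\<close> has full outer measure.\<close>

definition full_outer_values :: "('b \<Rightarrow> 'a measure) \<Rightarrow> 'a set \<Rightarrow> 'b set" where
  "full_outer_values \<kappa> S = {v. outer_measure_of (\<kappa> v) S = 1}"

definition restricted_domain ::
  "'w measure \<Rightarrow> (nat \<Rightarrow> 'w \<Rightarrow> 'x) \<Rightarrow> ('w \<Rightarrow> 't) \<Rightarrow> ('w \<Rightarrow> 'y) \<Rightarrow> 'x set \<Rightarrow> 't set \<Rightarrow> 'y set \<Rightarrow> 'w set" where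
  "restricted_domain M X \<Theta> Y SX ST SY =
     {\<omega> \<in> space M. (\<forall>i. X i \<omega> \<in> SX) \<and> \<Theta> \<omega> \<in> ST \<and> Y \<omega> \<in> SY}"

text \<open>\<open>P[\<cdot>|\<Omega>t]\<close> as a probability measure on the set \<open>\<Omega>t\<close>.\<close>

definition conditioned_on :: "'w measure \<Rightarrow> 'w set \<Rightarrow> 'w measure" where
  "conditioned_on M \<Omega>t = restrict_space (uniform_measure M \<Omega>t) \<Omega>t"

text \<open>
  The restricted parameter and hyperparameter spaces are subsets with trace sigma-algebras, so their
  inclusion maps are identities.  The composition of \<open>T n\<close> with the embeddings may leave \<open>Yt\<close> on a null
  set; there the pulled-back index is given an arbitrary fixed value \<open>y0 \<in> Yt\<close>.
\<close>

definition embedded_index ::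
  "('z \<Rightarrow> 'x) \<Rightarrow> (nat \<Rightarrow> (nat \<Rightarrow> 'x) \<times> 'y \<Rightarrow> 'y) \<Rightarrow> nat \<Rightarrow> (nat \<Rightarrow> 'z) \<times> 'y \<Rightarrow> 'y" where
  "embedded_index J T n = (\<lambda>(x, y). T n (\<lambda>i\<in>{..<n}. J (x i), y))"

definition pullback_index ::
  "('z \<Rightarrow> 'x) \<Rightarrow> 'y set \<Rightarrow> 'y \<Rightarrow> (nat \<Rightarrow> (nat \<Rightarrow> 'x) \<times> 'y \<Rightarrow> 'y) \<Rightarrow> nat \<Rightarrow> (nat \<Rightarrow> 'z) \<times> 'y \<Rightarrow> 'y" where
  "pullback_index J Yt y0 T n z = (if embedded_index J T n z \<in> Yt then embedded_index J T n z else y0)"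

end

theory Submission
  imports Defs
begin

text \<open>
  Given the parameter kernel \<open>q\<close> and the observation kernel \<open>p\<close>, the joint law of
  \<open>(X\<^sub>1, \<dots>, X\<^sub>n, \<Theta>, Y)\<close> is determined by the law of \<open>Y\<close>: draw \<open>Y\<close>, then \<open>\<Theta>\<close> from \<open>q Y\<close>, then the
  observations independently from \<open>p \<Theta>\<close>.  Two models with the same kernels, whose hyperparameter laws
  are related by a density \<open>f\<close>, therefore have joint laws related by the density \<open>f(Y)\<close>.  A density that
  is a function of the conditioning variables \<open>(X\<^sub>1, \<dots>, X\<^sub>n, Y)\<close> cancels in Bayes' formula, so both
  models have the same posterior (\<open>posterior_determined_by_kernels\<close>).

  This is the reason why conjugacy survives the restriction.  On \<open>\<Omega>t\<close> the restricted variables differ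
  from the original ones only by inclusion maps; they generate the same sigma-algebras and the
  pulled-back kernels assign to a trace the mass that the original kernels assign to the full set.
  Hence the restricted model, read through the inclusions, is a model with the kernels \<open>p\<close> and \<open>q\<close>
  under \<open>P[\<cdot>|\<Omega>t]\<close>, and the law of \<open>Y\<close> under this measure is absolutely continuous with respect to the
  original one.  The event \<open>\<Omega>t\<close> enters only through this law of \<open>Y\<close>.

  The index stays in \<open>Yt\<close> because membership of \<open>y\<close> in \<open>Yt\<close> means that \<open>q y\<close> does not charge the
  complement of \<open>Tt\<close>: on \<open>{Y \<in> Yt}\<close> the parameter lies in \<open>Tt\<close> almost surely, so the posterior, which
  by conjugacy is \<open>q\<close> at the value of the index, does not charge the complement either
  (\<open>AE_posterior_index_full\<close>).

  If the image of the embedding is a Borel set, then \<open>\<Omega>t\<close> equals \<open>{Y \<in> Yt}\<close> up to a null set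
  (\<open>\<Omega>t_AE_eq\<close>).  Conditioning on an event of the sigma-algebra of \<open>(\<Theta>, Y)\<close> changes no conditional
  probability given \<open>(\<Theta>, Y)\<close>, so the kernels persist under \<open>P[\<cdot>|\<Omega>t]\<close>.  Exchangeability follows from
  conditional independence, and the limiting empirical measure of the restricted observations is the
  pullback of the original one, which lives on the image of the embedding because all observations do.
\<close>

section \<open>Versions of conditional probabilities\<close>

text \<open>
  A variable and its image under an inclusion or embedding generate the same sigma-algebra, so conditional
  probabilities given either are literally the same function.  This moves every conditional probability of
  the restricted model back to the original spaces.
\<close>

lemma event_prob_given_vimage_algebra:
  assumes sets: "sets N' = sets (vimage_algebra (space N') j N)" and j: "j \<in> space N' \<rightarrow> space N"
    and V': "V' \<in> space M \<rightarrow> space N'" and V: "\<And>\<omega>. \<omega> \<in> space M \<Longrightarrow> V \<omega> = j (V' \<omega>)"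
  shows "event_prob_given M N' V' E = event_prob_given M N V E"
proof -
  have "vimage_algebra (space M) V' N' = vimage_algebra (space M) V' (vimage_algebra (space N') j N)"
    using sets by (intro vimage_algebra_cong) auto
  also have "\<dots> = vimage_algebra (space M) (\<lambda>\<omega>. j (V' \<omega>)) N"
    using V' j by (rule vimage_algebra_vimage_algebra_eq)
  also have "\<dots> = vimage_algebra (space M) V N"
    using V by (intro vimage_algebra_cong) auto
  finally show ?thesis
    by (simp add: event_prob_given_def)
qed

text \<open>
  The defining property of conditional probability, in the form of extended nonnegative integrals, where no
  integrability conditions arise in later computations.
\<close>

lemma event_prob_given_eq_iff:
  assumes "prob_space M" and V: "V \<in> M \<rightarrow>\<^sub>M N" and E: "E \<inter> space M \<in> sets M"
    and g: "g \<in> borel_measurable N" and g01: "\<And>v. v \<in> space N \<Longrightarrow> 0 \<le> g v \<and> g v \<le> (1::real)"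
  shows "(AE \<omega> in M. event_prob_given M N V E \<omega> = g (V \<omega>)) \<longleftrightarrow>
    (\<forall>C\<in>sets N. emeasure M (E \<inter> V -` C \<inter> space M) = (\<integral>\<^sup>+\<omega>. ennreal (g (V \<omega>)) * indicator C (V \<omega>) \<partial>M))"
proof -
  interpret prob_space M by fact
  define F where "F = vimage_algebra (space M) V N"
  have V_space: "V \<in> space M \<rightarrow> space N"
    using V by (rule measurable_space[THEN funcsetI])
  have "sets F = {V -` C \<inter> space M | C. C \<in> sets N}"
    unfolding F_def using V_space by (rule sets_vimage_algebra2)
  have sub: "subalgebra M F"
    unfolding subalgebra_def F_def using sets_image_in_sets[OF refl V] by simp
  interpret finite_measure_subalgebra M F
    by standard (fact sub)
  have VF: "V \<in> F \<rightarrow>\<^sub>M N"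
    unfolding F_def using V_space by (rule measurable_vimage_algebra1)
  have gF: "(\<lambda>\<omega>. g (V \<omega>)) \<in> borel_measurable F"
    using VF g by (rule measurable_compose)
  have gM [measurable]: "(\<lambda>\<omega>. g (V \<omega>)) \<in> borel_measurable M"
    using V g by (rule measurable_compose)
  have g_bd: "0 \<le> g (V \<omega>)" "g (V \<omega>) \<le> 1" if "\<omega> \<in> space M" for \<omega>
    using g01 measurable_space[OF V that] by auto
  have int_g: "integrable M (\<lambda>\<omega>. g (V \<omega>))"
    by (rule integrable_const_bound[where B=1]) (use g_bd in auto)
  have [measurable]: "indicat_real E \<in> borel_measurable M"
    using E by (simp add: borel_measurable_indicator_iff Int_commute)
  have int_E: "integrable M (indicat_real E)"
    by (rule integrable_const_bound[where B=1]) auto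
  have char: "emeasure M (E \<inter> V -` C \<inter> space M) = ennreal (\<integral>\<omega>\<in>V -` C \<inter> space M. indicat_real E \<omega> \<partial>M)"
    "(\<integral>\<^sup>+\<omega>. ennreal (g (V \<omega>)) * indicator C (V \<omega>) \<partial>M) = ennreal (\<integral>\<omega>\<in>V -` C \<inter> space M. g (V \<omega>) \<partial>M)"
    if C: "C \<in> sets N" for C
  proof -
    have [measurable]: "V -` C \<inter> space M \<in> sets M"
      using V C by (rule measurable_sets)
    have "E \<inter> V -` C \<inter> space M = (E \<inter> space M) \<inter> (V -` C \<inter> space M)" by auto
    then have meas: "E \<inter> V -` C \<inter> space M \<in> sets M" using E by simp
    have "(\<integral>\<omega>\<in>V -` C \<inter> space M. indicat_real E \<omega> \<partial>M) = (\<integral>\<omega>. indicat_real (E \<inter> V -` C \<inter> space M) \<omega> \<partial>M)"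
      unfolding set_lebesgue_integral_def by (intro Bochner_Integration.integral_cong) (auto simp: indicator_def)
    also have "\<dots> = measure M (E \<inter> V -` C \<inter> space M)"
      using meas by (simp add: Int_absorb2)
    finally show "emeasure M (E \<inter> V -` C \<inter> space M) = ennreal (\<integral>\<omega>\<in>V -` C \<inter> space M. indicat_real E \<omega> \<partial>M)"
      by (simp add: emeasure_eq_measure)
    have "(\<integral>\<^sup>+\<omega>. ennreal (g (V \<omega>)) * indicator C (V \<omega>) \<partial>M)
        = (\<integral>\<^sup>+\<omega>. ennreal (indicator (V -` C \<inter> space M) \<omega> *\<^sub>R g (V \<omega>)) \<partial>M)"
      by (intro nn_integral_cong) (auto simp: indicator_def)
    also have "\<dots> = ennreal (\<integral>\<omega>. indicator (V -` C \<inter> space M) \<omega> *\<^sub>R g (V \<omega>) \<partial>M)"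
      by (intro nn_integral_eq_integral integrable_mult_indicator int_g) (use g_bd in \<open>auto simp: indicator_def\<close>)
    finally show "(\<integral>\<^sup>+\<omega>. ennreal (g (V \<omega>)) * indicator C (V \<omega>) \<partial>M)
        = ennreal (\<integral>\<omega>\<in>V -` C \<inter> space M. g (V \<omega>) \<partial>M)"
      by (simp add: set_lebesgue_integral_def)
  qed
  have nonneg: "0 \<le> (\<integral>\<omega>\<in>A. indicat_real E \<omega> \<partial>M)" "0 \<le> (\<integral>\<omega>\<in>A. g (V \<omega>) \<partial>M)" for A
    unfolding set_lebesgue_integral_def
    by (auto intro!: Bochner_Integration.integral_nonneg_AE AE_I2 simp: indicator_def g_bd)
  show ?thesis
    unfolding event_prob_given_def F_def[symmetric]
  proof (intro iffI ballI)
    fix C assume C: "C \<in> sets N" and ae: "AE \<omega> in M. real_cond_exp M F (indicator E) \<omega> = g (V \<omega>)"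
    have CF: "V -` C \<inter> space M \<in> sets F"
      unfolding F_def using C by (rule in_vimage_algebra)
    then have [measurable]: "V -` C \<inter> space M \<in> sets M"
      using sub by (auto simp: subalgebra_def)
    have "(\<integral>\<omega>\<in>V -` C \<inter> space M. indicat_real E \<omega> \<partial>M)
        = (\<integral>\<omega>\<in>V -` C \<inter> space M. real_cond_exp M F (indicator E) \<omega> \<partial>M)"
      using int_E CF by (rule real_cond_exp_intA)
    also have "\<dots> = (\<integral>\<omega>\<in>V -` C \<inter> space M. g (V \<omega>) \<partial>M)"
      unfolding set_lebesgue_integral_def using ae by (intro integral_cong_AE) auto
    finally show "emeasure M (E \<inter> V -` C \<inter> space M) = (\<integral>\<^sup>+\<omega>. ennreal (g (V \<omega>)) * indicator C (V \<omega>) \<partial>M)"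
      by (simp add: char[OF C])
  next
    assume *: "\<forall>C\<in>sets N. emeasure M (E \<inter> V -` C \<inter> space M)
      = (\<integral>\<^sup>+\<omega>. ennreal (g (V \<omega>)) * indicator C (V \<omega>) \<partial>M)"
    show "AE \<omega> in M. real_cond_exp M F (indicator E) \<omega> = g (V \<omega>)"
    proof (rule real_cond_exp_charact[OF _ int_E int_g gF])
      fix A assume "A \<in> sets F"
      with \<open>sets F = _\<close> obtain C where C: "C \<in> sets N" and A: "A = V -` C \<inter> space M" by auto
      have "ennreal (\<integral>\<omega>\<in>A. indicat_real E \<omega> \<partial>M) = ennreal (\<integral>\<omega>\<in>A. g (V \<omega>) \<partial>M)"
        using *[rule_format, OF C] unfolding A char[OF C] .
      then show "(\<integral>\<omega>\<in>A. indicat_real E \<omega> \<partial>M) = (\<integral>\<omega>\<in>A. g (V \<omega>) \<partial>M)"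
        using nonneg by (simp add: ennreal_inj)
    qed
  qed
qed

text \<open>
  Events enter as subsets of the type rather than of \<open>space M\<close>, whence the need to pass between events that
  agree only on the space.
\<close>

lemma event_prob_given_AE_cong:
  assumes "prob_space M" and V: "V \<in> M \<rightarrow>\<^sub>M N"
    and E: "E \<inter> space M \<in> sets M" and eq: "E \<inter> space M = E' \<inter> space M"
  shows "AE \<omega> in M. event_prob_given M N V E \<omega> = event_prob_given M N V E' \<omega>"
proof -
  interpret prob_space M by fact
  have "subalgebra M (vimage_algebra (space M) V N)"
    unfolding subalgebra_def using sets_image_in_sets[OF refl V] by simp
  then interpret finite_measure_subalgebra M "vimage_algebra (space M) V N"
    by unfold_locales
  show ?thesis
    unfolding event_prob_given_def
  proof (rule real_cond_exp_cong)
    show "AE \<omega> in M. indicat_real E \<omega> = indicat_real E' \<omega>"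
      using eq by (auto simp: indicator_def)
    show "indicat_real E \<in> borel_measurable M" "indicat_real E' \<in> borel_measurable M"
      using E eq by (simp_all add: borel_measurable_indicator_iff Int_commute)
  qed
qed

text \<open>
  The averaging property extends from indicators of events of the conditioning variable to arbitrary
  nonnegative weights, since both sides are integrals with respect to two measures which agree.
\<close>

lemma nn_integral_event_prob_given:
  assumes "prob_space M" and V: "V \<in> M \<rightarrow>\<^sub>M N" and E: "E \<inter> space M \<in> sets M"
    and g: "g \<in> borel_measurable N" and g01: "\<And>v. v \<in> space N \<Longrightarrow> 0 \<le> g v \<and> g v \<le> (1::real)"
    and ae: "AE \<omega> in M. event_prob_given M N V E \<omega> = g (V \<omega>)"
    and \<psi>: "\<psi> \<in> borel_measurable N"
  shows "(\<integral>\<^sup>+\<omega>. indicator E \<omega> * \<psi> (V \<omega>) \<partial>M) = (\<integral>\<^sup>+\<omega>. ennreal (g (V \<omega>)) * \<psi> (V \<omega>) \<partial>M)"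
proof -
  note [measurable] = V g \<psi>
  have [measurable]: "(indicator E :: _ \<Rightarrow> ennreal) \<in> borel_measurable M"
    using E by (simp add: borel_measurable_indicator_iff Int_commute)
  have "distr (density M (indicator E)) N V = distr (density M (\<lambda>\<omega>. ennreal (g (V \<omega>)))) N V"
  proof (rule measure_eqI)
    fix C assume "C \<in> sets (distr (density M (indicator E)) N V)"
    then have C [measurable]: "C \<in> sets N" by simp
    have "emeasure (distr (density M (indicator E)) N V) C
        = (\<integral>\<^sup>+\<omega>. indicator E \<omega> * indicator (V -` C \<inter> space M) \<omega> \<partial>M)"
      by (simp add: emeasure_distr emeasure_density)
    also have "\<dots> = (\<integral>\<^sup>+\<omega>. indicator (E \<inter> V -` C \<inter> space M) \<omega> \<partial>M)"
      by (intro nn_integral_cong) (auto simp: indicator_def)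
    also have "\<dots> = emeasure M (E \<inter> V -` C \<inter> space M)"
    proof (rule nn_integral_indicator)
      have "(E \<inter> space M) \<inter> (V -` C \<inter> space M) \<in> sets M"
        using E measurable_sets[OF V C] by (rule sets.Int)
      also have "(E \<inter> space M) \<inter> (V -` C \<inter> space M) = E \<inter> V -` C \<inter> space M" by auto
      finally show "E \<inter> V -` C \<inter> space M \<in> sets M" .
    qed
    also have "\<dots> = (\<integral>\<^sup>+\<omega>. ennreal (g (V \<omega>)) * indicator C (V \<omega>) \<partial>M)"
      using event_prob_given_eq_iff[OF assms(1) V E g g01] ae C by blast
    also have "\<dots> = emeasure (distr (density M (\<lambda>\<omega>. ennreal (g (V \<omega>)))) N V) C"
      by (auto simp: emeasure_distr emeasure_density intro!: nn_integral_cong split: split_indicator)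
    finally show "emeasure (distr (density M (indicator E)) N V) C
        = emeasure (distr (density M (\<lambda>\<omega>. ennreal (g (V \<omega>)))) N V) C" .
  qed simp
  then have "(\<integral>\<^sup>+v. \<psi> v \<partial>distr (density M (indicator E)) N V)
      = (\<integral>\<^sup>+v. \<psi> v \<partial>distr (density M (\<lambda>\<omega>. ennreal (g (V \<omega>)))) N V)"
    by simp
  then show ?thesis
    by (simp add: nn_integral_distr nn_integral_density)
qed

text \<open>
  Disintegration for products.  The case of an indicator is the averaging property with a weight; linearity and
  monotone convergence give the rest.
\<close>

lemma nn_integral_regular_conditional:
  assumes "prob_space M" and reg: "regular_conditional M A N U V \<kappa>"
    and \<phi>: "\<phi> \<in> borel_measurable A" and \<psi>: "\<psi> \<in> borel_measurable N"
  shows "(\<integral>\<^sup>+\<omega>. \<phi> (U \<omega>) * \<psi> (V \<omega>) \<partial>M) = (\<integral>\<^sup>+\<omega>. (\<integral>\<^sup>+u. \<phi> u \<partial>\<kappa> (V \<omega>)) * \<psi> (V \<omega>) \<partial>M)"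
proof -
  have U [measurable]: "U \<in> M \<rightarrow>\<^sub>M A" and V [measurable]: "V \<in> M \<rightarrow>\<^sub>M N"
    and \<kappa>: "\<kappa> \<in> N \<rightarrow>\<^sub>M prob_algebra A"
    and ae: "\<And>S. S \<in> sets A \<Longrightarrow> AE \<omega> in M. event_prob_given M N V (U -` S) \<omega> = measure (\<kappa> (V \<omega>)) S"
    using reg by (auto simp: regular_conditional_def)
  note [measurable] = \<psi> measurable_prob_algebraD[OF \<kappa>]
  have sets_\<kappa> [measurable_cong]: "sets (\<kappa> (V \<omega>)) = sets A" and prob: "prob_space (\<kappa> (V \<omega>))" if "\<omega> \<in> space M" for \<omega>
    using measurable_space[OF \<kappa> measurable_space[OF V that]] by (auto simp: space_prob_algebra)
  have inner [measurable]: "(\<lambda>\<omega>. \<integral>\<^sup>+u. \<phi> u \<partial>\<kappa> (V \<omega>)) \<in> borel_measurable M" if [measurable]: "\<phi> \<in> borel_measurable A" for \<phi>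
    by measurable
  show ?thesis
    using \<phi>
  proof (induction rule: borel_measurable_induct)
    case (cong f g)
    have "(\<integral>\<^sup>+\<omega>. f (U \<omega>) * \<psi> (V \<omega>) \<partial>M) = (\<integral>\<^sup>+\<omega>. g (U \<omega>) * \<psi> (V \<omega>) \<partial>M)"
      using cong measurable_space[OF U] by (intro nn_integral_cong) auto
    moreover have "(\<integral>\<^sup>+\<omega>. (\<integral>\<^sup>+u. f u \<partial>\<kappa> (V \<omega>)) * \<psi> (V \<omega>) \<partial>M) = (\<integral>\<^sup>+\<omega>. (\<integral>\<^sup>+u. g u \<partial>\<kappa> (V \<omega>)) * \<psi> (V \<omega>) \<partial>M)"
      using cong sets_eq_imp_space_eq[OF sets_\<kappa>]
      by (intro nn_integral_cong arg_cong2[where f="(*)"] refl) auto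
    ultimately show ?case using cong by simp
  next
    case (set S)
    have "(\<integral>\<^sup>+\<omega>. indicator S (U \<omega>) * \<psi> (V \<omega>) \<partial>M) = (\<integral>\<^sup>+\<omega>. indicator (U -` S) \<omega> * \<psi> (V \<omega>) \<partial>M)"
      by (intro nn_integral_cong) (auto simp: indicator_def)
    also have "\<dots> = (\<integral>\<^sup>+\<omega>. ennreal (measure (\<kappa> (V \<omega>)) S) * \<psi> (V \<omega>) \<partial>M)"
      using set ae[OF set] \<kappa> measurable_space[OF \<kappa>]
      by (intro nn_integral_event_prob_given[OF assms(1) V])
        (auto simp: space_prob_algebra intro: prob_space.prob_le_1)
    also have "\<dots> = (\<integral>\<^sup>+\<omega>. (\<integral>\<^sup>+u. indicator S u \<partial>\<kappa> (V \<omega>)) * \<psi> (V \<omega>) \<partial>M)"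
      using prob sets_\<kappa> set
      by (intro nn_integral_cong) (simp add: finite_measure.emeasure_eq_measure prob_space_def)
    finally show ?case .
  next
    case (mult f c)
    note [measurable] = mult(2)
    have "(\<integral>\<^sup>+\<omega>. (\<integral>\<^sup>+u. c * f u \<partial>\<kappa> (V \<omega>)) * \<psi> (V \<omega>) \<partial>M) = (\<integral>\<^sup>+\<omega>. c * ((\<integral>\<^sup>+u. f u \<partial>\<kappa> (V \<omega>)) * \<psi> (V \<omega>)) \<partial>M)"
      by (intro nn_integral_cong) (simp add: nn_integral_cmult sets_\<kappa> mult.assoc cong: measurable_cong_sets)
    then show ?case using mult by (simp add: nn_integral_cmult mult.assoc)
  next
    case (add f g)
    note [measurable] = add(1,3)
    have "(\<integral>\<^sup>+\<omega>. (\<integral>\<^sup>+u. g u + f u \<partial>\<kappa> (V \<omega>)) * \<psi> (V \<omega>) \<partial>M)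
        = (\<integral>\<^sup>+\<omega>. (\<integral>\<^sup>+u. g u \<partial>\<kappa> (V \<omega>)) * \<psi> (V \<omega>) + (\<integral>\<^sup>+u. f u \<partial>\<kappa> (V \<omega>)) * \<psi> (V \<omega>) \<partial>M)"
      by (intro nn_integral_cong) (simp add: nn_integral_add sets_\<kappa> distrib_right cong: measurable_cong_sets)
    then show ?case using add by (simp add: nn_integral_add distrib_right)
  next
    case (seq f)
    note [measurable] = seq(1)
    have f_mono: "f i u \<le> f j u" if "i \<le> j" for i j u
      using seq(3) that by (auto simp: mono_def le_fun_def)
    have inc: "incseq (\<lambda>i. f i u * c)" for u and c :: ennreal
      using f_mono by (auto simp: mono_def intro!: mult_right_mono)
    have "(\<integral>\<^sup>+\<omega>. Sup (range f) (U \<omega>) * \<psi> (V \<omega>) \<partial>M) = (\<integral>\<^sup>+\<omega>. (SUP i. f i (U \<omega>) * \<psi> (V \<omega>)) \<partial>M)"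
      by (simp add: SUP_mult_right_ennreal image_comp)
    also have "\<dots> = (SUP i. \<integral>\<^sup>+\<omega>. f i (U \<omega>) * \<psi> (V \<omega>) \<partial>M)"
      using f_mono by (intro nn_integral_monotone_convergence_SUP)
        (auto simp: mono_def le_fun_def intro!: mult_right_mono)
    also have "\<dots> = (SUP i. \<integral>\<^sup>+\<omega>. (\<integral>\<^sup>+u. f i u \<partial>\<kappa> (V \<omega>)) * \<psi> (V \<omega>) \<partial>M)"
      using seq by simp
    also have "\<dots> = (\<integral>\<^sup>+\<omega>. (SUP i. (\<integral>\<^sup>+u. f i u \<partial>\<kappa> (V \<omega>)) * \<psi> (V \<omega>)) \<partial>M)"
      using f_mono by (intro nn_integral_monotone_convergence_SUP[symmetric])
        (auto simp: mono_def le_fun_def intro!: mult_right_mono nn_integral_mono)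
    also have "\<dots> = (\<integral>\<^sup>+\<omega>. (\<integral>\<^sup>+u. Sup (range f) u \<partial>\<kappa> (V \<omega>)) * \<psi> (V \<omega>) \<partial>M)"
    proof (intro nn_integral_cong)
      fix \<omega> assume \<omega>: "\<omega> \<in> space M"
      have "(\<integral>\<^sup>+u. Sup (range f) u \<partial>\<kappa> (V \<omega>)) = (SUP i. \<integral>\<^sup>+u. f i u \<partial>\<kappa> (V \<omega>))"
        unfolding SUP_apply
        using seq by (intro nn_integral_monotone_convergence_SUP) (simp_all add: sets_\<kappa>[OF \<omega>] cong: measurable_cong_sets)
      then show "(SUP i. (\<integral>\<^sup>+u. f i u \<partial>\<kappa> (V \<omega>)) * \<psi> (V \<omega>)) = (\<integral>\<^sup>+u. Sup (range f) u \<partial>\<kappa> (V \<omega>)) * \<psi> (V \<omega>)"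
        by (simp add: SUP_mult_right_ennreal)
    qed
    finally show ?case .
  qed
qed

section \<open>The posterior depends only on the kernels\<close>

text \<open>
  The part of a Bayesian model that determines posteriors: the kernels alone, without exchangeability and
  without the representation of the parameter as a limit.
\<close>

definition hierarchical_model ::
  "'w measure \<Rightarrow> 'x measure \<Rightarrow> 't measure \<Rightarrow> 'y measure \<Rightarrow>
     (nat \<Rightarrow> 'w \<Rightarrow> 'x) \<Rightarrow> ('w \<Rightarrow> 't) \<Rightarrow> ('w \<Rightarrow> 'y) \<Rightarrow>
     ('t \<Rightarrow> 'x measure) \<Rightarrow> ('y \<Rightarrow> 't measure) \<Rightarrow> bool" where
  "hierarchical_model M MX MT MY X \<Theta> Y p q \<longleftrightarrow>
     prob_space M \<and> (\<forall>i. X i \<in> M \<rightarrow>\<^sub>M MX) \<and> p \<in> MT \<rightarrow>\<^sub>M prob_algebra MX \<and>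
     regular_conditional M MT MY \<Theta> Y q \<and> conditionally_iid M MX MT MY X \<Theta> Y p"

lemma bayesian_model_imp_hierarchical_model:
  "bayesian_model M MX MT MY X \<Theta> Y p q \<Longrightarrow> hierarchical_model M MX MT MY X \<Theta> Y p q"
  by (auto simp: bayesian_model_def hierarchical_model_def regular_conditional_def)

lemma measurable_prod_measure_kernel:
  assumes p: "p \<in> MT \<rightarrow>\<^sub>M prob_algebra MX" and B: "\<And>i. i < n \<Longrightarrow> B i \<in> sets MX"
  shows "(\<lambda>\<theta>. \<Prod>i<n. measure (p \<theta>) (B i)) \<in> borel_measurable MT"
  using measurable_compose[OF p measurable_measure_prob_algebra[OF B]] by measurable

lemma prod_measure_kernel_bounds:
  assumes p: "p \<in> MT \<rightarrow>\<^sub>M prob_algebra MX" and \<theta>: "\<theta> \<in> space MT"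
  shows "0 \<le> (\<Prod>i<n. measure (p \<theta>) (B i)) \<and> (\<Prod>i<n. measure (p \<theta>) (B i)) \<le> 1"
proof -
  have "prob_space (p \<theta>)"
    using measurable_space[OF p \<theta>] by (simp add: space_prob_algebra)
  then show ?thesis
    by (auto intro!: prod_nonneg prod_le_1 prob_space.prob_le_1)
qed

lemma sets_sample_event:
  fixes n :: nat
  assumes "\<And>i. X i \<in> M \<rightarrow>\<^sub>M MX" and "\<And>i. i < n \<Longrightarrow> B i \<in> sets MX"
  shows "{\<omega>. \<forall>i<n. X i \<omega> \<in> B i} \<inter> space M \<in> sets M"
proof -
  have "{\<omega> \<in> space M. \<forall>i\<in>{..<n}. X i \<omega> \<in> B i} \<in> sets M"
  proof (rule sets.sets_Collect_finite_All)
    fix i assume "i \<in> {..<n}"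
    then have "X i -` B i \<inter> space M \<in> sets M"
      using assms by (intro measurable_sets) auto
    then show "{\<omega> \<in> space M. X i \<omega> \<in> B i} \<in> sets M"
      by (simp add: vimage_def Int_def conj_commute)
  qed simp
  also have "{\<omega> \<in> space M. \<forall>i\<in>{..<n}. X i \<omega> \<in> B i} = {\<omega>. \<forall>i<n. X i \<omega> \<in> B i} \<inter> space M" by auto
  finally show ?thesis .
qed

lemma measurable_sample:
  assumes "\<And>i. X i \<in> M \<rightarrow>\<^sub>M MX"
  shows "(\<lambda>\<omega>. sample n X \<omega>) \<in> M \<rightarrow>\<^sub>M sample_space n MX"
  using assms by (intro measurable_restrict)

text \<open>
  The sampling scheme as a formula: weights depending on \<open>Y\<close> are carried along, so that the right-hand side
  involves the underlying measure only through the law of \<open>Y\<close>.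
\<close>

lemma nn_integral_hierarchical_model:
  assumes model: "hierarchical_model M MX MT MY X \<Theta> Y p q"
    and B: "\<And>i. i < n \<Longrightarrow> B i \<in> sets MX" and A: "A \<in> sets MT" and \<psi>: "\<psi> \<in> borel_measurable MY"
  shows "(\<integral>\<^sup>+\<omega>. indicator {\<omega>. \<forall>i<n. X i \<omega> \<in> B i} \<omega> * (indicator A (\<Theta> \<omega>) * \<psi> (Y \<omega>)) \<partial>M)
    = (\<integral>\<^sup>+\<omega>. (\<integral>\<^sup>+\<theta>. ennreal (\<Prod>i<n. measure (p \<theta>) (B i)) * indicator A \<theta> \<partial>q (Y \<omega>)) * \<psi> (Y \<omega>) \<partial>M)"
proof -
  have M: "prob_space M" and X: "\<And>i. X i \<in> M \<rightarrow>\<^sub>M MX" and p: "p \<in> MT \<rightarrow>\<^sub>M prob_algebra MX"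
    and reg: "regular_conditional M MT MY \<Theta> Y q" and iid: "conditionally_iid M MX MT MY X \<Theta> Y p"
    using model by (auto simp: hierarchical_model_def)
  have [measurable]: "\<Theta> \<in> M \<rightarrow>\<^sub>M MT" "Y \<in> M \<rightarrow>\<^sub>M MY"
    using reg by (auto simp: regular_conditional_def)
  note [measurable] = \<psi> A measurable_prod_measure_kernel[OF p B]
  let ?g = "\<lambda>v. \<Prod>i<n. measure (p (fst v)) (B i)"
  have "(\<integral>\<^sup>+\<omega>. indicator {\<omega>. \<forall>i<n. X i \<omega> \<in> B i} \<omega> * (indicator A (\<Theta> \<omega>) * \<psi> (Y \<omega>)) \<partial>M)
      = (\<integral>\<^sup>+\<omega>. indicator {\<omega>. \<forall>i<n. X i \<omega> \<in> B i} \<omega> * (\<lambda>v. indicator A (fst v) * \<psi> (snd v)) (\<Theta> \<omega>, Y \<omega>) \<partial>M)"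
    by simp
  also have "\<dots> = (\<integral>\<^sup>+\<omega>. ennreal (?g (\<Theta> \<omega>, Y \<omega>)) * (\<lambda>v. indicator A (fst v) * \<psi> (snd v)) (\<Theta> \<omega>, Y \<omega>) \<partial>M)"
  proof (rule nn_integral_event_prob_given[OF M])
    show "{\<omega>. \<forall>i<n. X i \<omega> \<in> B i} \<inter> space M \<in> sets M"
      using X B by (rule sets_sample_event)
    show "AE \<omega> in M. event_prob_given M (MT \<Otimes>\<^sub>M MY) (\<lambda>\<omega>. (\<Theta> \<omega>, Y \<omega>)) {\<omega>. \<forall>i<n. X i \<omega> \<in> B i} \<omega> = ?g (\<Theta> \<omega>, Y \<omega>)"
      using iid B by (auto simp: conditionally_iid_def)
    show "0 \<le> ?g v \<and> ?g v \<le> 1" if "v \<in> space (MT \<Otimes>\<^sub>M MY)" for v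
      using that by (intro prod_measure_kernel_bounds[OF p]) (auto simp: space_pair_measure)
  qed measurable
  also have "\<dots> = (\<integral>\<^sup>+\<omega>. (\<lambda>\<theta>. ennreal (\<Prod>i<n. measure (p \<theta>) (B i)) * indicator A \<theta>) (\<Theta> \<omega>) * \<psi> (Y \<omega>) \<partial>M)"
    by (simp add: mult.assoc)
  also have "\<dots> = (\<integral>\<^sup>+\<omega>. (\<integral>\<^sup>+\<theta>. ennreal (\<Prod>i<n. measure (p \<theta>) (B i)) * indicator A \<theta> \<partial>q (Y \<omega>)) * \<psi> (Y \<omega>) \<partial>M)"
    by (rule nn_integral_regular_conditional[OF M reg]) measurable
  finally show ?thesis .
qed

text \<open>
  Both laws agree on products of a cylinder and a hyperparameter event, by the formula for the sampling scheme
  with weight \<open>indicator C\<close> on one side and \<open>f * indicator C\<close> on the other.  The parameter enters through a fixed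
  event \<open>A\<close>, which keeps the generating rectangles two-dimensional.
\<close>

lemma joint_law_density:
  assumes M: "hierarchical_model M MX MT MY X \<Theta> Y p q"
    and M': "hierarchical_model M' MX MT MY X \<Theta> Y p q"
    and f: "f \<in> borel_measurable MY" and density: "distr M' MY Y = density (distr M MY Y) f"
    and A: "A \<in> sets MT"
  shows "distr (density M' (\<lambda>\<omega>. indicator A (\<Theta> \<omega>))) (sample_space n MX \<Otimes>\<^sub>M MY) (\<lambda>\<omega>. (sample n X \<omega>, Y \<omega>))
    = distr (density M (\<lambda>\<omega>. f (Y \<omega>) * indicator A (\<Theta> \<omega>))) (sample_space n MX \<Otimes>\<^sub>M MY) (\<lambda>\<omega>. (sample n X \<omega>, Y \<omega>))"
    (is "?L' = ?L")
proof -
  have X: "X i \<in> M \<rightarrow>\<^sub>M MX" "X i \<in> M' \<rightarrow>\<^sub>M MX" for i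
    using M M' by (auto simp: hierarchical_model_def)
  have p: "p \<in> MT \<rightarrow>\<^sub>M prob_algebra MX" and q: "q \<in> MY \<rightarrow>\<^sub>M prob_algebra MT"
    and [measurable]: "\<Theta> \<in> M \<rightarrow>\<^sub>M MT" "Y \<in> M \<rightarrow>\<^sub>M MY" "\<Theta> \<in> M' \<rightarrow>\<^sub>M MT" "Y \<in> M' \<rightarrow>\<^sub>M MY"
    using M M' by (auto simp: hierarchical_model_def regular_conditional_def)
  note [measurable] = f A measurable_sample[OF X(1)] measurable_sample[OF X(2)] measurable_prob_algebraD[OF q]
  interpret M': prob_space M'
    using M' by (simp add: hierarchical_model_def)
  have rectangle: "(\<integral>\<^sup>+\<omega>. indicator (sample n X -` (\<Pi>\<^sub>E i\<in>{..<n}. B i)) \<omega> * (indicator A (\<Theta> \<omega>) * indicator C (Y \<omega>)) \<partial>M')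
      = (\<integral>\<^sup>+\<omega>. indicator (sample n X -` (\<Pi>\<^sub>E i\<in>{..<n}. B i)) \<omega> * (indicator A (\<Theta> \<omega>) * (f (Y \<omega>) * indicator C (Y \<omega>))) \<partial>M)"
    if B: "\<And>i. i < n \<Longrightarrow> B i \<in> sets MX" and C [measurable]: "C \<in> sets MY" for B C
  proof -
    have ev: "sample n X -` (\<Pi>\<^sub>E i\<in>{..<n}. B i) = {\<omega>. \<forall>i<n. X i \<omega> \<in> B i}"
      by (simp add: set_eq_iff restrict_PiE_iff Pi_iff Ball_def)
    note [measurable] = measurable_prod_measure_kernel[OF p B]
    define G where "G y = (\<integral>\<^sup>+\<theta>. ennreal (\<Prod>i<n. measure (p \<theta>) (B i)) * indicator A \<theta> \<partial>q y)" for y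
    have [measurable]: "G \<in> borel_measurable MY"
      unfolding G_def by measurable
    have "(\<integral>\<^sup>+\<omega>. indicator (sample n X -` (\<Pi>\<^sub>E i\<in>{..<n}. B i)) \<omega> * (indicator A (\<Theta> \<omega>) * indicator C (Y \<omega>)) \<partial>M')
        = (\<integral>\<^sup>+\<omega>. G (Y \<omega>) * indicator C (Y \<omega>) \<partial>M')"
      unfolding ev G_def by (rule nn_integral_hierarchical_model[OF M' B A]) auto
    also have "\<dots> = (\<integral>\<^sup>+y. G y * indicator C y \<partial>distr M' MY Y)"
      by (simp add: nn_integral_distr)
    also have "\<dots> = (\<integral>\<^sup>+\<omega>. G (Y \<omega>) * (f (Y \<omega>) * indicator C (Y \<omega>)) \<partial>M)"
      unfolding density by (simp add: nn_integral_density nn_integral_distr ac_simps)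
    also have "\<dots> = (\<integral>\<^sup>+\<omega>. indicator (sample n X -` (\<Pi>\<^sub>E i\<in>{..<n}. B i)) \<omega> * (indicator A (\<Theta> \<omega>) * (f (Y \<omega>) * indicator C (Y \<omega>))) \<partial>M)"
      unfolding ev G_def by (rule nn_integral_hierarchical_model[OF M B A, symmetric]) auto
    finally show ?thesis .
  qed
  have finite: "finite_measure (distr (density M' h) N V)"
    if [measurable]: "h \<in> borel_measurable M'" "V \<in> M' \<rightarrow>\<^sub>M N" and "\<And>\<omega>. h \<omega> \<le> 1" for h N and V :: "_ \<Rightarrow> 'u"
  proof (intro finite_measure.finite_measure_distr finite_measureI)
    have "emeasure (density M' h) (space (density M' h)) = (\<integral>\<^sup>+\<omega>. h \<omega> \<partial>M')"
      by (simp add: emeasure_density)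
    also have "\<dots> \<le> (\<integral>\<^sup>+\<omega>. 1 \<partial>M')"
      using that by (intro nn_integral_mono)
    finally have "emeasure (density M' h) (space (density M' h)) \<le> (\<integral>\<^sup>+\<omega>. 1 \<partial>M')" .
    then show "emeasure (density M' h) (space (density M' h)) \<noteq> \<infinity>"
      by (auto simp: M'.emeasure_space_1 top_unique)
  qed simp
  have cylinder: "distr (density M' (\<lambda>\<omega>. indicator A (\<Theta> \<omega>) * indicator C (Y \<omega>))) (sample_space n MX) (sample n X)
      = distr (density M (\<lambda>\<omega>. f (Y \<omega>) * indicator A (\<Theta> \<omega>) * indicator C (Y \<omega>))) (sample_space n MX) (sample n X)"
    (is "?P' = ?P") if C [measurable]: "C \<in> sets MY" for C
  proof (rule measure_eqI_PiM_finite[of "{..<n}" ?P' "\<lambda>_. MX"])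
    fix B :: "nat \<Rightarrow> _" assume "\<And>i. i \<in> {..<n} \<Longrightarrow> B i \<in> sets MX"
    then have B: "\<And>i. i < n \<Longrightarrow> B i \<in> sets MX" by auto
    have "emeasure ?P' (Pi\<^sub>E {..<n} B)
        = (\<integral>\<^sup>+\<omega>. indicator (sample n X -` Pi\<^sub>E {..<n} B) \<omega> * (indicator A (\<Theta> \<omega>) * indicator C (Y \<omega>)) \<partial>M')"
      using B by (subst emeasure_distr)
        (auto simp: emeasure_density ac_simps indicator_def intro!: nn_integral_cong sets_PiM_I_finite)
    also have "\<dots> = (\<integral>\<^sup>+\<omega>. indicator (sample n X -` Pi\<^sub>E {..<n} B) \<omega> * (indicator A (\<Theta> \<omega>) * (f (Y \<omega>) * indicator C (Y \<omega>))) \<partial>M)"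
      using B C by (rule rectangle)
    also have "\<dots> = emeasure ?P (Pi\<^sub>E {..<n} B)"
      using B by (subst emeasure_distr)
        (auto simp: emeasure_density ac_simps indicator_def intro!: nn_integral_cong sets_PiM_I_finite)
    finally show "emeasure ?P' (Pi\<^sub>E {..<n} B) = emeasure ?P (Pi\<^sub>E {..<n} B)" .
  next
    show "range (\<lambda>_. space (sample_space n MX)) \<subseteq> prod_algebra {..<n} (\<lambda>_. MX)"
      using space_in_prod_algebra[of "{..<n}" "\<lambda>_. MX"] by (auto simp: space_PiM)
    show "emeasure ?P' (space (sample_space n MX)) \<noteq> \<infinity>"
      unfolding infinity_ennreal_def
      by (rule finite_measure.emeasure_finite[OF finite]) (auto simp: indicator_def)
  qed (auto simp: space_PiM)
  let ?E = "{S \<times> C | S C. S \<in> sets (sample_space n MX) \<and> C \<in> sets MY}"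
  let ?S = "space (sample_space n MX)"
  show ?thesis
  proof (rule measure_eqI_generator_eq[OF Int_stable_pair_measure_generator])
    show "?E \<subseteq> Pow (?S \<times> space MY)"
      by (rule pair_measure_closed)
    fix D assume "D \<in> ?E"
    then obtain S C where D: "D = S \<times> C" and [measurable]: "S \<in> sets (sample_space n MX)" "C \<in> sets MY"
      by auto
    have "emeasure ?L' D = emeasure (distr (density M' (\<lambda>\<omega>. indicator A (\<Theta> \<omega>) * indicator C (Y \<omega>))) (sample_space n MX) (sample n X)) S"
      unfolding D by (simp add: emeasure_distr emeasure_density) (auto intro!: nn_integral_cong simp: indicator_def)
    also have "\<dots> = emeasure (distr (density M (\<lambda>\<omega>. f (Y \<omega>) * indicator A (\<Theta> \<omega>) * indicator C (Y \<omega>))) (sample_space n MX) (sample n X)) S"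
      by (simp add: cylinder)
    also have "\<dots> = emeasure ?L D"
      unfolding D by (simp add: emeasure_distr emeasure_density) (auto intro!: nn_integral_cong simp: indicator_def)
    finally show "emeasure ?L' D = emeasure ?L D" .
  next
    show "sets ?L' = sigma_sets (?S \<times> space MY) ?E" "sets ?L = sigma_sets (?S \<times> space MY) ?E"
      by (simp_all add: sets_pair_measure)
    show "range (\<lambda>_. ?S \<times> space MY) \<subseteq> ?E" by auto
    show "emeasure ?L' (?S \<times> space MY) \<noteq> \<infinity>"
      unfolding infinity_ennreal_def
      by (rule finite_measure.emeasure_finite[OF finite]) (auto simp: indicator_def)
  qed auto
qed

text \<open>
  The density of the joint laws is \<open>f(Y)\<close>, a function of the conditioning variables, and can therefore be used as
  a weight when the posterior of the first model is averaged.
\<close>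

lemma posterior_determined_by_kernels:
  assumes M: "hierarchical_model M MX MT MY X \<Theta> Y p q"
    and M': "hierarchical_model M' MX MT MY X \<Theta> Y p q"
    and ac: "absolutely_continuous (distr M MY Y) (distr M' MY Y)"
    and A: "A \<in> sets MT" and g: "g \<in> borel_measurable (sample_space n MX \<Otimes>\<^sub>M MY)"
    and g01: "\<And>v. v \<in> space (sample_space n MX \<Otimes>\<^sub>M MY) \<Longrightarrow> 0 \<le> g v \<and> g v \<le> (1::real)"
    and posterior: "AE \<omega> in M. event_prob_given M (sample_space n MX \<Otimes>\<^sub>M MY) (\<lambda>\<omega>. (sample n X \<omega>, Y \<omega>)) (\<Theta> -` A) \<omega>
      = g (sample n X \<omega>, Y \<omega>)"
  shows "AE \<omega> in M'. event_prob_given M' (sample_space n MX \<Otimes>\<^sub>M MY) (\<lambda>\<omega>. (sample n X \<omega>, Y \<omega>)) (\<Theta> -` A) \<omega>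
      = g (sample n X \<omega>, Y \<omega>)"
proof -
  define N where "N = sample_space n MX \<Otimes>\<^sub>M MY"
  define V where "V = (\<lambda>\<omega>. (sample n X \<omega>, Y \<omega>))"
  have pM: "prob_space M" and pM': "prob_space M'"
    and X: "\<And>i. X i \<in> M \<rightarrow>\<^sub>M MX" "\<And>i. X i \<in> M' \<rightarrow>\<^sub>M MX"
    and \<Theta> [measurable]: "\<Theta> \<in> M \<rightarrow>\<^sub>M MT" "\<Theta> \<in> M' \<rightarrow>\<^sub>M MT"
    and Y [measurable]: "Y \<in> M \<rightarrow>\<^sub>M MY" "Y \<in> M' \<rightarrow>\<^sub>M MY"
    using M M' by (auto simp: hierarchical_model_def regular_conditional_def)
  note [measurable] = A g[folded N_def]
  have V [measurable]: "V \<in> M \<rightarrow>\<^sub>M N" "V \<in> M' \<rightarrow>\<^sub>M N"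
    unfolding V_def N_def
    using measurable_sample[of X M] measurable_sample[of X M'] X by measurable
  interpret D: prob_space "distr M MY Y"
    using pM Y(1) by (rule prob_space.prob_space_distr)
  define f where "f = RN_deriv (distr M MY Y) (distr M' MY Y)"
  have f [measurable]: "f \<in> borel_measurable MY"
    using borel_measurable_RN_deriv[of "distr M MY Y" "distr M' MY Y"] by (simp add: f_def)
  have density: "distr M' MY Y = density (distr M MY Y) f"
    unfolding f_def using ac by (intro D.density_RN_deriv[symmetric]) auto
  have law: "(\<integral>\<^sup>+\<omega>. indicator A (\<Theta> \<omega>) * h (V \<omega>) \<partial>M') = (\<integral>\<^sup>+\<omega>. f (Y \<omega>) * indicator A (\<Theta> \<omega>) * h (V \<omega>) \<partial>M)"
    if [measurable]: "A \<in> sets MT" and h [measurable]: "h \<in> borel_measurable N" for A h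
  proof -
    have "(\<integral>\<^sup>+v. h v \<partial>distr (density M' (\<lambda>\<omega>. indicator A (\<Theta> \<omega>))) N V)
        = (\<integral>\<^sup>+v. h v \<partial>distr (density M (\<lambda>\<omega>. f (Y \<omega>) * indicator A (\<Theta> \<omega>))) N V)"
      using joint_law_density[OF M M' f density, of A n] that by (simp add: V_def N_def)
    then show ?thesis
      by (simp add: nn_integral_distr nn_integral_density)
  qed
  have law': "(\<integral>\<^sup>+\<omega>. h (V \<omega>) \<partial>M') = (\<integral>\<^sup>+\<omega>. f (Y \<omega>) * h (V \<omega>) \<partial>M)"
    if "h \<in> borel_measurable N" for h
  proof -
    have "(\<integral>\<^sup>+\<omega>. h (V \<omega>) \<partial>M') = (\<integral>\<^sup>+\<omega>. indicator (space MT) (\<Theta> \<omega>) * h (V \<omega>) \<partial>M')"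
      using measurable_space[OF \<Theta>(2)] by (intro nn_integral_cong) simp
    also have "\<dots> = (\<integral>\<^sup>+\<omega>. f (Y \<omega>) * indicator (space MT) (\<Theta> \<omega>) * h (V \<omega>) \<partial>M)"
      using that by (intro law) auto
    also have "\<dots> = (\<integral>\<^sup>+\<omega>. f (Y \<omega>) * h (V \<omega>) \<partial>M)"
      using measurable_space[OF \<Theta>(1)] by (intro nn_integral_cong) simp
    finally show ?thesis .
  qed
  have E: "\<Theta> -` A \<inter> space M \<in> sets M" "\<Theta> -` A \<inter> space M' \<in> sets M'"
    by measurable
  have g01': "\<And>v. v \<in> space N \<Longrightarrow> 0 \<le> g v \<and> g v \<le> 1"
    using g01 by (simp add: N_def)
  have posterior': "AE \<omega> in M. event_prob_given M N V (\<Theta> -` A) \<omega> = g (V \<omega>)"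
    using posterior by (simp add: N_def V_def)
  have "AE \<omega> in M'. event_prob_given M' N V (\<Theta> -` A) \<omega> = g (V \<omega>)"
  proof (rule event_prob_given_eq_iff[OF pM' V(2) E(2) g[folded N_def] g01', THEN iffD2, rule_format])
    fix C assume [measurable]: "C \<in> sets N"
    have snd_V: "Y \<omega> = snd (V \<omega>)" for \<omega> by (simp add: V_def)
    have [measurable]: "snd \<in> N \<rightarrow>\<^sub>M MY" by (simp add: N_def)
    have "emeasure M' (\<Theta> -` A \<inter> V -` C \<inter> space M') = (\<integral>\<^sup>+\<omega>. indicator (\<Theta> -` A \<inter> V -` C \<inter> space M') \<omega> \<partial>M')"
    proof (rule nn_integral_indicator[symmetric])
      have "(\<Theta> -` A \<inter> space M') \<inter> (V -` C \<inter> space M') \<in> sets M'"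
        by measurable
      also have "(\<Theta> -` A \<inter> space M') \<inter> (V -` C \<inter> space M') = \<Theta> -` A \<inter> V -` C \<inter> space M'" by auto
      finally show "\<Theta> -` A \<inter> V -` C \<inter> space M' \<in> sets M'" .
    qed
    also have "\<dots> = (\<integral>\<^sup>+\<omega>. indicator A (\<Theta> \<omega>) * indicator C (V \<omega>) \<partial>M')"
      by (intro nn_integral_cong) (auto simp: indicator_def)
    also have "\<dots> = (\<integral>\<^sup>+\<omega>. f (Y \<omega>) * indicator A (\<Theta> \<omega>) * indicator C (V \<omega>) \<partial>M)"
      by (rule law) auto
    also have "\<dots> = (\<integral>\<^sup>+\<omega>. indicator (\<Theta> -` A) \<omega> * (\<lambda>v. f (snd v) * indicator C v) (V \<omega>) \<partial>M)"
      unfolding snd_V by (intro nn_integral_cong) (auto simp: indicator_def)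
    also have "\<dots> = (\<integral>\<^sup>+\<omega>. ennreal (g (V \<omega>)) * (\<lambda>v. f (snd v) * indicator C v) (V \<omega>) \<partial>M)"
      using posterior' g01' by (intro nn_integral_event_prob_given[OF pM V(1) E(1)]) simp_all
    also have "\<dots> = (\<integral>\<^sup>+\<omega>. f (Y \<omega>) * (\<lambda>v. ennreal (g v) * indicator C v) (V \<omega>) \<partial>M)"
      unfolding snd_V by (simp add: ac_simps)
    also have "\<dots> = (\<integral>\<^sup>+\<omega>. ennreal (g (V \<omega>)) * indicator C (V \<omega>) \<partial>M')"
      by (rule law'[symmetric]) auto
    finally show "emeasure M' (\<Theta> -` A \<inter> V -` C \<inter> space M') = (\<integral>\<^sup>+\<omega>. ennreal (g (V \<omega>)) * indicator C (V \<omega>) \<partial>M')" .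
  qed
  then show ?thesis
    by (simp add: N_def V_def)
qed

section \<open>Consequences of conditional independence\<close>

text \<open>
  The tower property: a test set \<open>C\<close> for \<open>V\<close> is the test set \<open>C \<times> space L\<close> for \<open>(V, W)\<close>.
\<close>

lemma AE_event_prob_given_fst:
  assumes M: "prob_space M" and V: "V \<in> M \<rightarrow>\<^sub>M N" and W: "W \<in> M \<rightarrow>\<^sub>M L" and E: "E \<inter> space M \<in> sets M"
    and g: "g \<in> borel_measurable N" and g01: "\<And>v. v \<in> space N \<Longrightarrow> 0 \<le> g v \<and> g v \<le> (1::real)"
    and ae: "AE \<omega> in M. event_prob_given M (N \<Otimes>\<^sub>M L) (\<lambda>\<omega>. (V \<omega>, W \<omega>)) E \<omega> = g (V \<omega>)"
  shows "AE \<omega> in M. event_prob_given M N V E \<omega> = g (V \<omega>)"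
proof (rule event_prob_given_eq_iff[OF M V E g g01, THEN iffD2, rule_format])
  fix C assume C: "C \<in> sets N"
  have VW: "(\<lambda>\<omega>. (V \<omega>, W \<omega>)) \<in> M \<rightarrow>\<^sub>M N \<Otimes>\<^sub>M L"
    using V W by measurable
  have g': "(\<lambda>v. g (fst v)) \<in> borel_measurable (N \<Otimes>\<^sub>M L)"
    using g by measurable
  have "emeasure M (E \<inter> V -` C \<inter> space M) = emeasure M (E \<inter> (\<lambda>\<omega>. (V \<omega>, W \<omega>)) -` (C \<times> space L) \<inter> space M)"
    using measurable_space[OF W] by (intro arg_cong[where f="emeasure M"]) auto
  also have "\<dots> = (\<integral>\<^sup>+\<omega>. ennreal (g (V \<omega>)) * indicator (C \<times> space L) (V \<omega>, W \<omega>) \<partial>M)"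
    using event_prob_given_eq_iff[OF M VW E g'] g01 ae C by (auto simp: space_pair_measure)
  also have "\<dots> = (\<integral>\<^sup>+\<omega>. ennreal (g (V \<omega>)) * indicator C (V \<omega>) \<partial>M)"
    using measurable_space[OF W] by (intro nn_integral_cong) (auto simp: indicator_def)
  finally show "emeasure M (E \<inter> V -` C \<inter> space M) = (\<integral>\<^sup>+\<omega>. ennreal (g (V \<omega>)) * indicator C (V \<omega>) \<partial>M)" .
qed auto

lemma hierarchical_model_regular_conditional:
  assumes model: "hierarchical_model M MX MT MY X \<Theta> Y p q"
  shows "regular_conditional M MX MT (X i) \<Theta> p"
proof -
  have M: "prob_space M" and X: "\<And>i. X i \<in> M \<rightarrow>\<^sub>M MX" and p: "p \<in> MT \<rightarrow>\<^sub>M prob_algebra MX"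
    and \<Theta>: "\<Theta> \<in> M \<rightarrow>\<^sub>M MT" and Y: "Y \<in> M \<rightarrow>\<^sub>M MY" and iid: "conditionally_iid M MX MT MY X \<Theta> Y p"
    using model by (auto simp: hierarchical_model_def regular_conditional_def)
  have prob: "prob_space (p \<theta>)" "sets (p \<theta>) = sets MX" if "\<theta> \<in> space MT" for \<theta>
    using measurable_space[OF p that] by (auto simp: space_prob_algebra)
  have "AE \<omega> in M. event_prob_given M MT \<Theta> (X i -` S) \<omega> = measure (p (\<Theta> \<omega>)) S" if S: "S \<in> sets MX" for S
  proof (rule AE_event_prob_given_fst[OF M \<Theta> Y])
    show E: "X i -` S \<inter> space M \<in> sets M"
      using X S by (rule measurable_sets)
    show "(\<lambda>\<theta>. measure (p \<theta>) S) \<in> borel_measurable MT"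
      using p measurable_measure_prob_algebra[OF S] by (rule measurable_compose)
    show "0 \<le> measure (p \<theta>) S \<and> measure (p \<theta>) S \<le> 1" if "\<theta> \<in> space MT" for \<theta>
      using prob[OF that] by (auto intro: prob_space.prob_le_1)
    \<comment> \<open>The event for the single observation \<open>X i\<close> is a product event with trivial constraints on the others.\<close>
    define B where "B j = (if j = i then S else space MX)" for j
    have B: "\<forall>j<Suc i. B j \<in> sets MX"
      using S by (simp add: B_def)
    have \<Theta>Y: "(\<lambda>\<omega>. (\<Theta> \<omega>, Y \<omega>)) \<in> M \<rightarrow>\<^sub>M MT \<Otimes>\<^sub>M MY"
      using \<Theta> Y by measurable
    have "AE \<omega> in M. event_prob_given M (MT \<Otimes>\<^sub>M MY) (\<lambda>\<omega>. (\<Theta> \<omega>, Y \<omega>)) (X i -` S) \<omega>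
        = event_prob_given M (MT \<Otimes>\<^sub>M MY) (\<lambda>\<omega>. (\<Theta> \<omega>, Y \<omega>)) {\<omega>. \<forall>j<Suc i. X j \<omega> \<in> B j} \<omega>"
      using measurable_space[OF X]
      by (intro event_prob_given_AE_cong[OF M \<Theta>Y E]) (auto simp: B_def split: if_splits)
    moreover have "AE \<omega> in M. event_prob_given M (MT \<Otimes>\<^sub>M MY) (\<lambda>\<omega>. (\<Theta> \<omega>, Y \<omega>)) {\<omega>. \<forall>j<Suc i. X j \<omega> \<in> B j} \<omega>
        = (\<Prod>j<Suc i. measure (p (\<Theta> \<omega>)) (B j))"
      using iid B unfolding conditionally_iid_def by blast
    moreover have "(\<Prod>j<Suc i. measure (p \<theta>) (B j)) = measure (p \<theta>) S" if \<theta>: "\<theta> \<in> space MT" for \<theta>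
    proof -
      have "measure (p \<theta>) (B j) = (if j = i then measure (p \<theta>) S else 1)" for j
        using prob_space.prob_space[OF prob(1)[OF \<theta>]] sets_eq_imp_space_eq[OF prob(2)[OF \<theta>]] by (simp add: B_def)
      then show ?thesis
        by simp
    qed
    ultimately show "AE \<omega> in M. event_prob_given M (MT \<Otimes>\<^sub>M MY) (\<lambda>\<omega>. (\<Theta> \<omega>, Y \<omega>)) (X i -` S) \<omega>
        = measure (p (\<Theta> \<omega>)) S"
      using AE_space[of M] measurable_space[OF \<Theta>] by (elim AE_mp) (auto intro!: AE_I2)
  qed
  then show ?thesis
    using X \<Theta> p by (simp add: regular_conditional_def)
qed

text \<open>
  The probability of a product event is an integral of \<open>\<Prod>i<n. measure (p \<theta>) (B i)\<close>, which is symmetric in the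
  factors.
\<close>

lemma hierarchical_model_exchangeable:
  assumes model: "hierarchical_model M MX MT MY X \<Theta> Y p q"
  shows "exchangeable M MX X"
  unfolding exchangeable_def
proof (intro allI impI)
  fix n and \<pi> :: "nat \<Rightarrow> nat" assume \<pi>: "\<pi> permutes {..<n}"
  have M: "prob_space M" and X: "\<And>i. X i \<in> M \<rightarrow>\<^sub>M MX"
    and \<Theta>: "\<Theta> \<in> M \<rightarrow>\<^sub>M MT" and Y: "Y \<in> M \<rightarrow>\<^sub>M MY"
    using model by (auto simp: hierarchical_model_def regular_conditional_def)
  have law: "emeasure (distr M (sample_space n MX) (sample n Z)) (Pi\<^sub>E {..<n} B)
      = emeasure M ({\<omega>. \<forall>i<n. Z i \<omega> \<in> B i} \<inter> space M)"
    if "\<And>i. Z i \<in> M \<rightarrow>\<^sub>M MX" and "\<And>i. i < n \<Longrightarrow> B i \<in> sets MX" for Z B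
  proof -
    have "sample n Z -` Pi\<^sub>E {..<n} B = {\<omega>. \<forall>i<n. Z i \<omega> \<in> B i}"
      by (simp add: set_eq_iff restrict_PiE_iff Pi_iff Ball_def)
    then show ?thesis
      using that measurable_sample[of Z M MX n] by (subst emeasure_distr) (auto intro!: sets_PiM_I_finite)
  qed
  have prob: "emeasure M ({\<omega>. \<forall>i<n. X i \<omega> \<in> B i} \<inter> space M)
      = (\<integral>\<^sup>+\<omega>. (\<integral>\<^sup>+\<theta>. ennreal (\<Prod>i<n. measure (p \<theta>) (B i)) * indicator (space MT) \<theta> \<partial>q (Y \<omega>)) * 1 \<partial>M)"
    if B: "\<And>i. i < n \<Longrightarrow> B i \<in> sets MX" for B
  proof -
    have "emeasure M ({\<omega>. \<forall>i<n. X i \<omega> \<in> B i} \<inter> space M)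
        = (\<integral>\<^sup>+\<omega>. indicator ({\<omega>. \<forall>i<n. X i \<omega> \<in> B i} \<inter> space M) \<omega> \<partial>M)"
      using sets_sample_event[OF X B] by (rule nn_integral_indicator[symmetric])
    also have "\<dots> = (\<integral>\<^sup>+\<omega>. indicator {\<omega>. \<forall>i<n. X i \<omega> \<in> B i} \<omega> * (indicator (space MT) (\<Theta> \<omega>) * (\<lambda>_. 1) (Y \<omega>)) \<partial>M)"
      using measurable_space[OF \<Theta>] by (intro nn_integral_cong) (auto simp: indicator_def)
    also have "\<dots> = (\<integral>\<^sup>+\<omega>. (\<integral>\<^sup>+\<theta>. ennreal (\<Prod>i<n. measure (p \<theta>) (B i)) * indicator (space MT) \<theta> \<partial>q (Y \<omega>)) * (\<lambda>_. 1) (Y \<omega>) \<partial>M)"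
      using B by (rule nn_integral_hierarchical_model[OF model]) auto
    finally show ?thesis .
  qed
  show "distr M (sample_space n MX) (sample n (X \<circ> \<pi>)) = distr M (sample_space n MX) (sample n X)"
  proof (rule measure_eqI_PiM_finite[of "{..<n}" _ "\<lambda>_. MX"])
    fix B :: "nat \<Rightarrow> _" assume "\<And>i. i \<in> {..<n} \<Longrightarrow> B i \<in> sets MX"
    then have B: "B i \<in> sets MX" if "i < n" for i using that by auto
    define B' where "B' i = B (inv \<pi> i)" for i
    have \<pi>_less: "\<pi> i < n \<longleftrightarrow> i < n" for i
      using permutes_in_image[OF \<pi>, of i] by simp
    have inv_less: "inv \<pi> i < n \<longleftrightarrow> i < n" for i
      using permutes_in_image[OF permutes_inv[OF \<pi>], of i] by simp
    have B': "B' i \<in> sets MX" if "i < n" for i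
      using B that by (simp add: B'_def inv_less)
    have "emeasure (distr M (sample_space n MX) (sample n (X \<circ> \<pi>))) (Pi\<^sub>E {..<n} B)
        = emeasure M ({\<omega>. \<forall>i<n. X (\<pi> i) \<omega> \<in> B i} \<inter> space M)"
      using law[of "X \<circ> \<pi>" B] X B by simp
    also have "{\<omega>. \<forall>i<n. X (\<pi> i) \<omega> \<in> B i} = {\<omega>. \<forall>i<n. X i \<omega> \<in> B' i}"
    proof (intro Collect_cong iffI allI impI)
      fix \<omega> i assume *: "\<forall>i<n. X (\<pi> i) \<omega> \<in> B i" and "i < n"
      then show "X i \<omega> \<in> B' i"
        using *[rule_format, of "inv \<pi> i"] by (simp add: inv_less B'_def permutes_inverses[OF \<pi>])
    next
      fix \<omega> i assume *: "\<forall>i<n. X i \<omega> \<in> B' i" and "i < n"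
      then show "X (\<pi> i) \<omega> \<in> B i"
        using *[rule_format, of "\<pi> i"] by (simp add: \<pi>_less B'_def permutes_inverses[OF \<pi>])
    qed
    also have "emeasure M ({\<omega>. \<forall>i<n. X i \<omega> \<in> B' i} \<inter> space M) = emeasure M ({\<omega>. \<forall>i<n. X i \<omega> \<in> B i} \<inter> space M)"
    proof -
      have "(\<Prod>i<n. measure (p \<theta>) (B' i)) = (\<Prod>i<n. measure (p \<theta>) (B i))" for \<theta>
        unfolding B'_def using prod.permute[OF permutes_inv[OF \<pi>], of "\<lambda>i. measure (p \<theta>) (B i)"]
        by (simp add: comp_def)
      then show ?thesis
        using prob[OF B'] prob[OF B] by simp
    qed
    also have "\<dots> = emeasure (distr M (sample_space n MX) (sample n X)) (Pi\<^sub>E {..<n} B)"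
      using law[of X B] X B by simp
    finally show "emeasure (distr M (sample_space n MX) (sample n (X \<circ> \<pi>))) (Pi\<^sub>E {..<n} B)
        = emeasure (distr M (sample_space n MX) (sample n X)) (Pi\<^sub>E {..<n} B)" .
  next
    show "range (\<lambda>_. space (sample_space n MX)) \<subseteq> prod_algebra {..<n} (\<lambda>_. MX)"
      using space_in_prod_algebra[of "{..<n}" "\<lambda>_. MX"] by (auto simp: space_PiM)
    have "prob_space (distr M (sample_space n MX) (sample n (X \<circ> \<pi>)))"
      using M by (rule prob_space.prob_space_distr) (rule measurable_sample, simp add: X)
    then interpret D: prob_space "distr M (sample_space n MX) (sample n (X \<circ> \<pi>))" .
    show "emeasure (distr M (sample_space n MX) (sample n (X \<circ> \<pi>))) (space (sample_space n MX)) \<noteq> \<infinity>"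
      unfolding infinity_ennreal_def by (rule D.emeasure_finite)
  qed (auto simp: space_PiM)
qed

section \<open>Pulled-back sigma-algebras\<close>

text \<open>
  Measurability of the identity expresses that the vimage algebra is large enough; for product spaces it can
  be checked componentwise.
\<close>

lemma sets_eq_vimage_algebraI:
  assumes "j \<in> N' \<rightarrow>\<^sub>M N" and "(\<lambda>z. z) \<in> vimage_algebra (space N') j N \<rightarrow>\<^sub>M N'"
  shows "sets N' = sets (vimage_algebra (space N') j N)"
proof
  show "sets (vimage_algebra (space N') j N) \<subseteq> sets N'"
    using assms(1) by (rule sets_image_in_sets[OF refl])
  show "sets N' \<subseteq> sets (vimage_algebra (space N') j N)"
  proof
    fix S assume S: "S \<in> sets N'"
    then have "S \<inter> space N' \<in> sets (vimage_algebra (space N') j N)"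
      using measurable_sets[OF assms(2) S] by simp
    then show "S \<in> sets (vimage_algebra (space N') j N)"
      using sets.sets_into_space[OF S] by (simp add: Int_absorb2)
  qed
qed

lemma measurable_vimage_algebra_sets:
  assumes sets: "sets N' = sets (vimage_algebra (space N') j N)"
    and "g \<in> space L \<rightarrow> space N'" and "(\<lambda>x. j (g x)) \<in> L \<rightarrow>\<^sub>M N"
  shows "g \<in> L \<rightarrow>\<^sub>M N'"
  using measurable_vimage_algebra2[of g L "space N'" j N] assms(2,3) measurable_cong_sets[OF refl sets, of L] by simp

lemma sets_pair_vimage_algebra:
  assumes 1: "sets N1' = sets (vimage_algebra (space N1') j1 N1)" and j1: "j1 \<in> N1' \<rightarrow>\<^sub>M N1"
    and 2: "sets N2' = sets (vimage_algebra (space N2') j2 N2)" and j2: "j2 \<in> N2' \<rightarrow>\<^sub>M N2"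
  shows "sets (N1' \<Otimes>\<^sub>M N2') = sets (vimage_algebra (space (N1' \<Otimes>\<^sub>M N2')) (\<lambda>(x, y). (j1 x, j2 y)) (N1 \<Otimes>\<^sub>M N2))"
proof (rule sets_eq_vimage_algebraI)
  let ?j = "\<lambda>(x, y). (j1 x, j2 y)" and ?V = "vimage_algebra (space (N1' \<Otimes>\<^sub>M N2')) (\<lambda>(x, y). (j1 x, j2 y)) (N1 \<Otimes>\<^sub>M N2)"
  show j: "?j \<in> N1' \<Otimes>\<^sub>M N2' \<rightarrow>\<^sub>M N1 \<Otimes>\<^sub>M N2"
    using j1 j2 by measurable
  have V: "?j \<in> ?V \<rightarrow>\<^sub>M N1 \<Otimes>\<^sub>M N2"
    using measurable_space[OF j] by (intro measurable_vimage_algebra1) auto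
  have "fst \<in> ?V \<rightarrow>\<^sub>M N1'"
  proof (rule measurable_vimage_algebra_sets[OF 1])
    show "(\<lambda>x. j1 (fst x)) \<in> ?V \<rightarrow>\<^sub>M N1"
      using measurable_compose[OF V measurable_fst] by (simp add: case_prod_beta)
  qed (auto simp: space_pair_measure)
  moreover have "snd \<in> ?V \<rightarrow>\<^sub>M N2'"
  proof (rule measurable_vimage_algebra_sets[OF 2])
    show "(\<lambda>x. j2 (snd x)) \<in> ?V \<rightarrow>\<^sub>M N2"
      using measurable_compose[OF V measurable_snd] by (simp add: case_prod_beta)
  qed (auto simp: space_pair_measure)
  ultimately show "(\<lambda>z. z) \<in> ?V \<rightarrow>\<^sub>M N1' \<Otimes>\<^sub>M N2'"
    by (auto intro!: measurable_pair simp: comp_def)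
qed

lemma measurable_sample_map:
  assumes "j \<in> N' \<rightarrow>\<^sub>M N"
  shows "(\<lambda>x. \<lambda>i\<in>{..<n}. j (x i)) \<in> sample_space n N' \<rightarrow>\<^sub>M sample_space n N"
  using assms by (intro measurable_restrict measurable_compose[OF measurable_component_singleton])

lemma sets_sample_vimage_algebra:
  assumes sets: "sets N' = sets (vimage_algebra (space N') j N)" and j: "j \<in> N' \<rightarrow>\<^sub>M N"
  shows "sets (sample_space n N') = sets (vimage_algebra (space (sample_space n N')) (\<lambda>x. \<lambda>i\<in>{..<n}. j (x i)) (sample_space n N))"
proof (rule sets_eq_vimage_algebraI)
  let ?j = "\<lambda>x. \<lambda>i\<in>{..<n}. j (x i)"
  let ?V = "vimage_algebra (space (sample_space n N')) ?j (sample_space n N)"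
  show J: "?j \<in> sample_space n N' \<rightarrow>\<^sub>M sample_space n N"
    using j by (rule measurable_sample_map)
  have V: "?j \<in> ?V \<rightarrow>\<^sub>M sample_space n N"
    using measurable_space[OF J] by (intro measurable_vimage_algebra1) auto
  show "(\<lambda>z. z) \<in> ?V \<rightarrow>\<^sub>M sample_space n N'"
  proof (rule measurable_PiM_single')
    fix i assume i: "i \<in> {..<n}"
    show "(\<lambda>x. x i) \<in> ?V \<rightarrow>\<^sub>M N'"
    proof (rule measurable_vimage_algebra_sets[OF sets])
      show "(\<lambda>x. j (x i)) \<in> ?V \<rightarrow>\<^sub>M N"
        using measurable_compose[OF V measurable_component_singleton[OF i]] i by simp
    qed (use i in \<open>auto simp: space_PiM PiE_iff\<close>)
  qed (simp add: space_PiM)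
qed

section \<open>Conditioning on an event\<close>

lemma space_conditioned_on: "S \<in> sets M \<Longrightarrow> space (conditioned_on M S) = S"
  using sets.sets_into_space[of S M] by (auto simp: conditioned_on_def space_restrict_space)

lemma sets_conditioned_on: "S \<in> sets M \<Longrightarrow> A \<in> sets (conditioned_on M S) \<longleftrightarrow> A \<in> sets M \<and> A \<subseteq> S"
  using sets.sets_into_space[of S M]
  by (auto simp: conditioned_on_def sets_restrict_space_iff Int_absorb2)

lemma measurable_conditioned_on: "f \<in> M \<rightarrow>\<^sub>M N \<Longrightarrow> f \<in> conditioned_on M S \<rightarrow>\<^sub>M N"
  by (simp add: conditioned_on_def measurable_restrict_space1)

lemma emeasure_conditioned_on:
  assumes "S \<in> sets M" "A \<in> sets M" "A \<subseteq> S"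
  shows "emeasure (conditioned_on M S) A = emeasure M A / emeasure M S"
  using assms sets.sets_into_space[of S M]
  by (simp add: conditioned_on_def emeasure_restrict_space Int_absorb1 Int_absorb2)

lemma nn_integral_conditioned_on:
  assumes "S \<in> sets M" and h: "h \<in> borel_measurable M"
  shows "(\<integral>\<^sup>+\<omega>. h \<omega> \<partial>conditioned_on M S) = (\<integral>\<^sup>+\<omega>. h \<omega> * indicator S \<omega> \<partial>M) / emeasure M S"
proof -
  have "(\<integral>\<^sup>+\<omega>. h \<omega> \<partial>conditioned_on M S) = (\<integral>\<^sup>+\<omega>. h \<omega> * indicator S \<omega> \<partial>uniform_measure M S)"
    unfolding conditioned_on_def using assms by (intro nn_integral_restrict_space) auto
  also have "\<dots> = (\<integral>\<^sup>+\<omega>. h \<omega> * indicator S \<omega> * indicator S \<omega> \<partial>M) / emeasure M S"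
    using assms by (intro nn_integral_uniform_measure) auto
  also have "(\<integral>\<^sup>+\<omega>. h \<omega> * indicator S \<omega> * indicator S \<omega> \<partial>M) = (\<integral>\<^sup>+\<omega>. h \<omega> * indicator S \<omega> \<partial>M)"
    by (intro nn_integral_cong) (auto simp: indicator_def)
  finally show ?thesis .
qed

lemma
  assumes M: "prob_space M" and S: "S \<in> sets M" and pos: "emeasure M S \<noteq> 0"
  shows prob_space_conditioned_on: "prob_space (conditioned_on M S)"
    and AE_conditioned_on: "(AE \<omega> in conditioned_on M S. P \<omega>) \<longleftrightarrow> (AE \<omega> in M. \<omega> \<in> S \<longrightarrow> P \<omega>)"
proof -
  interpret prob_space M by fact
  have fin: "emeasure M S < \<infinity>" "emeasure M S \<noteq> \<infinity>"
    by (simp_all add: less_top[symmetric])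
  show "prob_space (conditioned_on M S)"
    unfolding conditioned_on_def
    using S pos fin by (intro prob_space_restrict_space) (auto simp: emeasure_uniform_measure_1)
  have "(AE \<omega> in conditioned_on M S. P \<omega>) \<longleftrightarrow> (AE \<omega> in uniform_measure M S. \<omega> \<in> S \<longrightarrow> P \<omega>)"
    unfolding conditioned_on_def using S by (intro AE_restrict_space_iff) auto
  also have "\<dots> \<longleftrightarrow> (AE \<omega> in M. \<omega> \<in> S \<longrightarrow> P \<omega>)"
    using AE_uniform_measure[OF pos fin(1), of "\<lambda>\<omega>. \<omega> \<in> S \<longrightarrow> P \<omega>"] by simp
  finally show "(AE \<omega> in conditioned_on M S. P \<omega>) \<longleftrightarrow> (AE \<omega> in M. \<omega> \<in> S \<longrightarrow> P \<omega>)" .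
qed

lemma absolutely_continuous_distr_conditioned_on:
  assumes S: "S \<in> sets M" and Y: "Y \<in> M \<rightarrow>\<^sub>M N"
  shows "absolutely_continuous (distr M N Y) (distr (conditioned_on M S) N Y)"
  unfolding absolutely_continuous_def
proof
  fix C assume "C \<in> null_sets (distr M N Y)"
  then have C: "C \<in> sets N" and null: "Y -` C \<inter> space M \<in> null_sets M"
    using Y by (auto simp: null_sets_distr_iff)
  have Y': "Y \<in> conditioned_on M S \<rightarrow>\<^sub>M N"
    using Y by (rule measurable_conditioned_on)
  have set: "Y -` C \<inter> S \<in> sets M"
    using measurable_sets[OF Y' C] S by (simp add: space_conditioned_on sets_conditioned_on)
  have "emeasure M (Y -` C \<inter> S) = 0"
    using emeasure_mono[of "Y -` C \<inter> S" "Y -` C \<inter> space M" M] null sets.sets_into_space[OF S]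
    by (auto simp: null_sets_def)
  then have "emeasure (distr (conditioned_on M S) N Y) C = 0"
    using set S by (simp add: emeasure_distr[OF Y' C] space_conditioned_on emeasure_conditioned_on)
  then show "C \<in> null_sets (distr (conditioned_on M S) N Y)"
    using C by (simp add: null_sets_def)
qed

text \<open>
  Conditioning on an event that is, up to a null set, determined by \<open>V\<close> changes no conditional probability
  given \<open>V\<close>: the event is just one more test set in the defining property.
\<close>

lemma AE_event_prob_given_conditioned_on:
  assumes M: "prob_space M" and S: "S \<in> sets M" and pos: "emeasure M S \<noteq> 0"
    and V: "V \<in> M \<rightarrow>\<^sub>M N" and E: "E \<inter> space M \<in> sets M"
    and C0: "C0 \<in> sets N" and S_eq: "AE \<omega> in M. \<omega> \<in> S \<longleftrightarrow> V \<omega> \<in> C0"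
    and g: "g \<in> borel_measurable N" and g01: "\<And>v. v \<in> space N \<Longrightarrow> 0 \<le> g v \<and> g v \<le> (1::real)"
    and ae: "AE \<omega> in M. event_prob_given M N V E \<omega> = g (V \<omega>)"
  shows "AE \<omega> in conditioned_on M S. event_prob_given (conditioned_on M S) N V E \<omega> = g (V \<omega>)"
proof -
  let ?M = "conditioned_on M S"
  have V': "V \<in> ?M \<rightarrow>\<^sub>M N"
    using V by (rule measurable_conditioned_on)
  have ES: "E \<inter> S \<in> sets M"
    using sets.Int[OF E S] sets.sets_into_space[OF S] by (simp add: Int_assoc Int_absorb1)
  then have E': "E \<inter> space ?M \<in> sets ?M"
    using S by (simp add: space_conditioned_on sets_conditioned_on)
  show ?thesis
  proof (rule event_prob_given_eq_iff[OF prob_space_conditioned_on[OF M S pos] V' E' g g01, THEN iffD2, rule_format])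
    fix C assume C: "C \<in> sets N"
    note [measurable] = V g C
    have meas: "E \<inter> V -` C \<inter> S \<in> sets M"
      using sets.Int[OF ES measurable_sets[OF V C]] sets.sets_into_space[OF S]
      by (auto simp: Int_assoc intro: back_subst[of "\<lambda>A. A \<in> sets M"])
    have meas': "E \<inter> V -` (C \<inter> C0) \<inter> space M \<in> sets M"
      using sets.Int[OF E measurable_sets[OF V sets.Int[OF C C0]]]
      by (auto simp: Int_ac intro: back_subst[of "\<lambda>A. A \<in> sets M"])
    have "emeasure M (E \<inter> V -` C \<inter> S) = emeasure M (E \<inter> V -` (C \<inter> C0) \<inter> space M)"
      using S_eq sets.sets_into_space[OF S] meas meas' by (intro emeasure_eq_AE) auto
    also have "\<dots> = (\<integral>\<^sup>+\<omega>. ennreal (g (V \<omega>)) * indicator (C \<inter> C0) (V \<omega>) \<partial>M)"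
      using event_prob_given_eq_iff[OF M V E g g01] ae C C0 by blast
    also have "\<dots> = (\<integral>\<^sup>+\<omega>. ennreal (g (V \<omega>)) * indicator C (V \<omega>) * indicator S \<omega> \<partial>M)"
      using S_eq by (intro nn_integral_cong_AE) (auto simp: indicator_def)
    finally have eq: "emeasure M (E \<inter> V -` C \<inter> S)
        = (\<integral>\<^sup>+\<omega>. ennreal (g (V \<omega>)) * indicator C (V \<omega>) * indicator S \<omega> \<partial>M)" .
    have "emeasure ?M (E \<inter> V -` C \<inter> space ?M) = emeasure M (E \<inter> V -` C \<inter> S) / emeasure M S"
      using S meas by (simp add: space_conditioned_on emeasure_conditioned_on)
    also have "\<dots> = (\<integral>\<^sup>+\<omega>. ennreal (g (V \<omega>)) * indicator C (V \<omega>) \<partial>?M)"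
      unfolding eq by (intro nn_integral_conditioned_on[OF S, symmetric]) measurable
    finally show "emeasure ?M (E \<inter> V -` C \<inter> space ?M) = (\<integral>\<^sup>+\<omega>. ennreal (g (V \<omega>)) * indicator C (V \<omega>) \<partial>?M)" .
  qed auto
qed

section \<open>Embeddings and pullbacks\<close>

text \<open>
  A Borel embedding carries no structure of its own: the sigma-algebra of its domain is pulled back from the
  target.  This turns embeddings and inclusions into the same situation.
\<close>

lemma sets_borel_embedding:
  assumes J: "borel_embedding Xt N J" and sub: "J ` space Xt \<subseteq> space N"
  shows "J \<in> Xt \<rightarrow>\<^sub>M N" and "sets Xt = sets (vimage_algebra (space Xt) J N)"
proof -
  have inj: "inj_on J (space Xt)" and J': "J \<in> Xt \<rightarrow>\<^sub>M restrict_space N (J ` space Xt)"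
    and inv: "inv_into (space Xt) J \<in> restrict_space N (J ` space Xt) \<rightarrow>\<^sub>M Xt"
    using J by (auto simp: borel_embedding_def)
  show JN: "J \<in> Xt \<rightarrow>\<^sub>M N"
    using J' by (simp add: measurable_restrict_space2_iff)
  let ?V = "vimage_algebra (space Xt) J N"
  have JV: "J \<in> ?V \<rightarrow>\<^sub>M restrict_space N (J ` space Xt)"
    using sub by (intro measurable_restrict_space2 measurable_vimage_algebra1) auto
  have "(\<lambda>z. inv_into (space Xt) J (J z)) \<in> ?V \<rightarrow>\<^sub>M Xt"
    using JV inv by (rule measurable_compose)
  then have "(\<lambda>z. z) \<in> ?V \<rightarrow>\<^sub>M Xt"
    by (rule measurable_cong[THEN iffD1, rotated]) (simp add: inv_into_f_f[OF inj])
  with JN show "sets Xt = sets ?V"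
    by (rule sets_eq_vimage_algebraI)
qed

lemma sets_restrict_space_vimage:
  assumes "S \<subseteq> space N"
  shows "sets (restrict_space N S) = sets (vimage_algebra (space (restrict_space N S)) (\<lambda>x. x) N)"
  using restrict_space_eq_vimage_algebra[OF assms] assms by (simp add: space_restrict_space Int_absorb2)

lemma measure_pullback:
  assumes pull: "is_pullback Z J \<nu> \<nu>'" and S: "S \<in> sets \<nu>"
  shows "measure \<nu>' (J -` S \<inter> Z) = measure \<nu> S"
proof -
  have sub: "J ` Z \<subseteq> space \<nu>" and sets: "sets \<nu>' = sets (vimage_algebra Z J \<nu>)" and distr: "distr \<nu>' \<nu> J = \<nu>"
    using pull by (auto simp: is_pullback_def)
  have space: "space \<nu>' = Z"
    using sets_eq_imp_space_eq[OF sets] by simp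
  have "J \<in> \<nu>' \<rightarrow>\<^sub>M \<nu>"
    using measurable_vimage_algebra1[of J Z \<nu>] sub measurable_cong_sets[OF sets refl, of \<nu>] by auto
  then have "measure (distr \<nu>' \<nu> J) S = measure \<nu>' (J -` S \<inter> Z)"
    using S by (simp add: measure_distr space)
  then show ?thesis by (simp add: distr)
qed

lemma regular_conditional_pullback_iff:
  assumes M: "prob_space M"
    and U': "U' \<in> M \<rightarrow>\<^sub>M A'" and V': "V' \<in> M \<rightarrow>\<^sub>M N'"
    and A': "sets A' = sets (vimage_algebra (space A') j A)" and j: "j \<in> A' \<rightarrow>\<^sub>M A"
    and N': "sets N' = sets (vimage_algebra (space N') i N)" and i: "i \<in> N' \<rightarrow>\<^sub>M N"
    and U: "U \<in> M \<rightarrow>\<^sub>M A" "\<And>\<omega>. \<omega> \<in> space M \<Longrightarrow> U \<omega> = j (U' \<omega>)"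
    and V: "V \<in> M \<rightarrow>\<^sub>M N" "\<And>\<omega>. \<omega> \<in> space M \<Longrightarrow> V \<omega> = i (V' \<omega>)"
    and \<kappa>': "\<kappa>' \<in> N' \<rightarrow>\<^sub>M prob_algebra A'" and \<kappa>: "\<kappa> \<in> N \<rightarrow>\<^sub>M prob_algebra A"
    and pull: "\<And>v S. v \<in> space N' \<Longrightarrow> S \<in> sets A \<Longrightarrow> measure (\<kappa>' v) (j -` S \<inter> space A') = measure (\<kappa> (i v)) S"
  shows "regular_conditional M A' N' U' V' \<kappa>' \<longleftrightarrow> regular_conditional M A N U V \<kappa>"
proof -
  have eq: "event_prob_given M N' V' E = event_prob_given M N V E" for E
    using V(2) measurable_space[OF i] measurable_space[OF V']
    by (intro event_prob_given_vimage_algebra[OF N']) auto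
  have step: "(AE \<omega> in M. event_prob_given M N' V' (U' -` (j -` S \<inter> space A')) \<omega> = measure (\<kappa>' (V' \<omega>)) (j -` S \<inter> space A'))
      \<longleftrightarrow> (AE \<omega> in M. event_prob_given M N V (U -` S) \<omega> = measure (\<kappa> (V \<omega>)) S)" if S: "S \<in> sets A" for S
  proof -
    have "AE \<omega> in M. event_prob_given M N V (U -` S) \<omega> = event_prob_given M N V (U' -` (j -` S \<inter> space A')) \<omega>"
      using U(2) measurable_space[OF U'] measurable_sets[OF U(1) S]
      by (intro event_prob_given_AE_cong[OF M V(1)]) auto
    moreover have "measure (\<kappa>' (V' \<omega>)) (j -` S \<inter> space A') = measure (\<kappa> (V \<omega>)) S" if "\<omega> \<in> space M" for \<omega>
      using pull[OF measurable_space[OF V' that] S] V(2)[OF that] by simp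
    ultimately show ?thesis
      unfolding eq by (intro AE_cong_simp iffI) (auto elim!: AE_mp)
  qed
  have sets: "sets A' = (\<lambda>S. j -` S \<inter> space A') ` sets A"
    unfolding A' using sets_vimage_algebra2[of j "space A'" A] measurable_space[OF j] by auto
  have "(\<forall>S'\<in>sets A'. AE \<omega> in M. event_prob_given M N' V' (U' -` S') \<omega> = measure (\<kappa>' (V' \<omega>)) S')
      \<longleftrightarrow> (\<forall>S\<in>sets A. AE \<omega> in M. event_prob_given M N V (U -` S) \<omega> = measure (\<kappa> (V \<omega>)) S)"
  proof (intro iffI ballI)
    fix S assume *: "\<forall>S'\<in>sets A'. AE \<omega> in M. event_prob_given M N' V' (U' -` S') \<omega> = measure (\<kappa>' (V' \<omega>)) S'"
      and S: "S \<in> sets A"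
    have "j -` S \<inter> space A' \<in> sets A'"
      unfolding sets using S by blast
    with * step[OF S] show "AE \<omega> in M. event_prob_given M N V (U -` S) \<omega> = measure (\<kappa> (V \<omega>)) S"
      by blast
  next
    fix S' assume *: "\<forall>S\<in>sets A. AE \<omega> in M. event_prob_given M N V (U -` S) \<omega> = measure (\<kappa> (V \<omega>)) S"
      and S': "S' \<in> sets A'"
    obtain S where S: "S \<in> sets A" and S': "S' = j -` S \<inter> space A'"
      using S' unfolding sets by blast
    show "AE \<omega> in M. event_prob_given M N' V' (U' -` S') \<omega> = measure (\<kappa>' (V' \<omega>)) S'"
      unfolding S' step[OF S] using * S by blast
  qed
  then show ?thesis
    using U' V' U(1) V(1) \<kappa>' \<kappa> unfolding regular_conditional_def by blast
qed

text \<open>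
  Every measurable set of the restricted observation space is a preimage under \<open>J\<close>, the corresponding events agree,
  and the kernel masses agree by assumption.
\<close>

lemma conditionally_iid_pullback_iff:
  assumes M: "prob_space M"
    and X': "\<And>i. X' i \<in> M \<rightarrow>\<^sub>M MX'" and \<Theta>': "\<Theta> \<in> M \<rightarrow>\<^sub>M MT'" and Y': "Y \<in> M \<rightarrow>\<^sub>M MY'"
    and MX': "sets MX' = sets (vimage_algebra (space MX') J MX)" and J: "J \<in> MX' \<rightarrow>\<^sub>M MX"
    and MT': "sets MT' = sets (vimage_algebra (space MT') (\<lambda>\<theta>. \<theta>) MT)" and T: "(\<lambda>\<theta>. \<theta>) \<in> MT' \<rightarrow>\<^sub>M MT"
    and MY': "sets MY' = sets (vimage_algebra (space MY') (\<lambda>y. y) MY)" and Y: "(\<lambda>y. y) \<in> MY' \<rightarrow>\<^sub>M MY"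
    and X: "\<And>i. X i \<in> M \<rightarrow>\<^sub>M MX" "\<And>i \<omega>. \<omega> \<in> space M \<Longrightarrow> X i \<omega> = J (X' i \<omega>)"
    and pull: "\<And>\<theta> S. \<theta> \<in> space MT' \<Longrightarrow> S \<in> sets MX \<Longrightarrow> measure (p' \<theta>) (J -` S \<inter> space MX') = measure (p \<theta>) S"
  shows "conditionally_iid M MX' MT' MY' X' \<Theta> Y p' \<longleftrightarrow> conditionally_iid M MX MT MY X \<Theta> Y p"
proof -
  have \<Theta>Y: "(\<lambda>\<omega>. (\<Theta> \<omega>, Y \<omega>)) \<in> M \<rightarrow>\<^sub>M MT' \<Otimes>\<^sub>M MY'" "(\<lambda>\<omega>. (\<Theta> \<omega>, Y \<omega>)) \<in> M \<rightarrow>\<^sub>M MT \<Otimes>\<^sub>M MY"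
    using measurable_compose[OF \<Theta>' T] measurable_compose[OF Y' Y] \<Theta>' Y' by simp_all
  have "(\<lambda>z. z) \<in> MT' \<Otimes>\<^sub>M MY' \<rightarrow>\<^sub>M MT \<Otimes>\<^sub>M MY"
    using measurable_compose[OF measurable_fst T] measurable_compose[OF measurable_snd Y]
    by (intro measurable_pair) (simp_all add: comp_def)
  then have id: "(\<lambda>z. z) \<in> space (MT' \<Otimes>\<^sub>M MY') \<rightarrow> space (MT \<Otimes>\<^sub>M MY)"
    by (auto dest: measurable_space)
  have "sets (MT' \<Otimes>\<^sub>M MY') = sets (vimage_algebra (space (MT' \<Otimes>\<^sub>M MY')) (\<lambda>z. z) (MT \<Otimes>\<^sub>M MY))"
    using sets_pair_vimage_algebra[OF MT' T MY' Y] unfolding case_prod_beta prod.collapse .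
  note pair = this
  have eq: "event_prob_given M (MT' \<Otimes>\<^sub>M MY') (\<lambda>\<omega>. (\<Theta> \<omega>, Y \<omega>)) E = event_prob_given M (MT \<Otimes>\<^sub>M MY) (\<lambda>\<omega>. (\<Theta> \<omega>, Y \<omega>)) E" for E
    using measurable_space[OF \<Theta>Y(1)] by (intro event_prob_given_vimage_algebra[OF pair id]) simp_all
  have step: "(AE \<omega> in M. event_prob_given M (MT' \<Otimes>\<^sub>M MY') (\<lambda>\<omega>. (\<Theta> \<omega>, Y \<omega>)) {\<omega>. \<forall>i<n. X' i \<omega> \<in> B' i} \<omega>
        = (\<Prod>i<n. measure (p' (\<Theta> \<omega>)) (B' i)))
      \<longleftrightarrow> (AE \<omega> in M. event_prob_given M (MT \<Otimes>\<^sub>M MY) (\<lambda>\<omega>. (\<Theta> \<omega>, Y \<omega>)) {\<omega>. \<forall>i<n. X i \<omega> \<in> B i} \<omega>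
        = (\<Prod>i<n. measure (p (\<Theta> \<omega>)) (B i)))"
    if B: "\<And>i. i < n \<Longrightarrow> B i \<in> sets MX" and B': "\<And>i. i < n \<Longrightarrow> B' i = J -` B i \<inter> space MX'" for n :: nat and B B'
  proof -
    have "X i \<omega> \<in> B i \<longleftrightarrow> X' i \<omega> \<in> B' i" if "\<omega> \<in> space M" "i < n" for i \<omega>
      using X(2)[OF that(1)] measurable_space[OF X' that(1)] B'[OF that(2)] by simp
    then have "{\<omega>. \<forall>i<n. X i \<omega> \<in> B i} \<inter> space M = {\<omega>. \<forall>i<n. X' i \<omega> \<in> B' i} \<inter> space M"
      by blast
    then have "AE \<omega> in M. event_prob_given M (MT \<Otimes>\<^sub>M MY) (\<lambda>\<omega>. (\<Theta> \<omega>, Y \<omega>)) {\<omega>. \<forall>i<n. X i \<omega> \<in> B i} \<omega>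
        = event_prob_given M (MT \<Otimes>\<^sub>M MY) (\<lambda>\<omega>. (\<Theta> \<omega>, Y \<omega>)) {\<omega>. \<forall>i<n. X' i \<omega> \<in> B' i} \<omega>"
      using sets_sample_event[of X M MX n B, OF X(1) B] by (intro event_prob_given_AE_cong[OF M \<Theta>Y(2)])
    moreover have "(\<Prod>i<n. measure (p' (\<Theta> \<omega>)) (B' i)) = (\<Prod>i<n. measure (p (\<Theta> \<omega>)) (B i))" if "\<omega> \<in> space M" for \<omega>
      using pull[OF measurable_space[OF \<Theta>' that] B] by (intro prod.cong) (auto simp: B')
    ultimately show ?thesis
      unfolding eq by (intro AE_cong_simp iffI) (auto elim!: AE_mp)
  qed
  have sets: "\<exists>S\<in>sets MX. S' = J -` S \<inter> space MX'" if "S' \<in> sets MX'" for S'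
  proof -
    have "sets MX' = {J -` S \<inter> space MX' | S. S \<in> sets MX}"
      by (rule trans[OF MX' sets_vimage_algebra2]) (use measurable_space[OF J] in auto)
    with that show ?thesis by blast
  qed
  show ?thesis
  proof
    assume iid: "conditionally_iid M MX' MT' MY' X' \<Theta> Y p'"
    show "conditionally_iid M MX MT MY X \<Theta> Y p"
      unfolding conditionally_iid_def
    proof (intro allI impI)
      fix n :: nat and B assume B: "\<forall>i<n. B i \<in> sets MX"
      define B' where "B' i = J -` B i \<inter> space MX'" for i
      have "\<forall>i<n. B' i \<in> sets MX'"
        using B J by (auto simp: B'_def intro: measurable_sets)
      then show "AE \<omega> in M. event_prob_given M (MT \<Otimes>\<^sub>M MY) (\<lambda>\<omega>. (\<Theta> \<omega>, Y \<omega>)) {\<omega>. \<forall>i<n. X i \<omega> \<in> B i} \<omega>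
          = (\<Prod>i<n. measure (p (\<Theta> \<omega>)) (B i))"
        using step[of n B B'] B B'_def iid[unfolded conditionally_iid_def, rule_format, of n B'] by blast
    qed
  next
    assume iid: "conditionally_iid M MX MT MY X \<Theta> Y p"
    show "conditionally_iid M MX' MT' MY' X' \<Theta> Y p'"
      unfolding conditionally_iid_def
    proof (intro allI impI)
      fix n :: nat and B' assume "\<forall>i<n. B' i \<in> sets MX'"
      then have *: "\<exists>S. S \<in> sets MX \<and> B' i = J -` S \<inter> space MX'" if "i < n" for i
        using sets[of "B' i"] that by blast
      define B where "B i = (SOME S. S \<in> sets MX \<and> B' i = J -` S \<inter> space MX')" for i
      have B: "B i \<in> sets MX" and B': "B' i = J -` B i \<inter> space MX'" if "i < n" for i
        using someI_ex[OF *[OF that]] by (simp_all add: B_def)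
      show "AE \<omega> in M. event_prob_given M (MT' \<Otimes>\<^sub>M MY') (\<lambda>\<omega>. (\<Theta> \<omega>, Y \<omega>)) {\<omega>. \<forall>i<n. X' i \<omega> \<in> B' i} \<omega>
          = (\<Prod>i<n. measure (p' (\<Theta> \<omega>)) (B' i))"
        using step[of n B B', OF B B'] iid[unfolded conditionally_iid_def, rule_format, of n B, OF B] by blast
    qed
  qed
qed

lemma event_prob_given_sample_pullback:
  assumes X': "\<And>i. X' i \<in> M \<rightarrow>\<^sub>M MX'" and Y': "Y \<in> M \<rightarrow>\<^sub>M MY'"
    and MX': "sets MX' = sets (vimage_algebra (space MX') J MX)" and J: "J \<in> MX' \<rightarrow>\<^sub>M MX"
    and MY': "sets MY' = sets (vimage_algebra (space MY') (\<lambda>y. y) MY)" and Y: "(\<lambda>y. y) \<in> MY' \<rightarrow>\<^sub>M MY"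
    and X: "\<And>i \<omega>. \<omega> \<in> space M \<Longrightarrow> X i \<omega> = J (X' i \<omega>)"
  shows "event_prob_given M (sample_space n MX' \<Otimes>\<^sub>M MY') (\<lambda>\<omega>. (sample n X' \<omega>, Y \<omega>)) E
    = event_prob_given M (sample_space n MX \<Otimes>\<^sub>M MY) (\<lambda>\<omega>. (sample n X \<omega>, Y \<omega>)) E"
proof (rule event_prob_given_vimage_algebra)
  let ?j = "\<lambda>(x, y). (\<lambda>i\<in>{..<n}. J (x i), y)"
  note j = measurable_sample_map[OF J, of n]
  show "sets (sample_space n MX' \<Otimes>\<^sub>M MY')
      = sets (vimage_algebra (space (sample_space n MX' \<Otimes>\<^sub>M MY')) ?j (sample_space n MX \<Otimes>\<^sub>M MY))"
    by (rule sets_pair_vimage_algebra[OF sets_sample_vimage_algebra[OF MX' J] j MY' Y])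
  show "?j \<in> space (sample_space n MX' \<Otimes>\<^sub>M MY') \<rightarrow> space (sample_space n MX \<Otimes>\<^sub>M MY)"
    using measurable_space[OF j] measurable_space[OF Y] by (auto simp: space_pair_measure)
  show "(\<lambda>\<omega>. (sample n X' \<omega>, Y \<omega>)) \<in> space M \<rightarrow> space (sample_space n MX' \<Otimes>\<^sub>M MY')"
    using measurable_space[OF measurable_sample[of X', OF X']] measurable_space[OF Y'] by (auto simp: space_pair_measure)
  show "(sample n X \<omega>, Y \<omega>) = ?j (sample n X' \<omega>, Y \<omega>)" if "\<omega> \<in> space M" for \<omega>
    using X[OF that] by (auto simp: restrict_def)
qed

section \<open>Sets of full outer measure\<close>

lemma standard_borel_restrict_space_iff: "standard_borel (restrict_space borel S) \<longleftrightarrow> S \<in> sets borel"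
proof
  assume "standard_borel (restrict_space borel S)"
  then obtain S' where S': "S' \<in> sets borel" and "sets (restrict_space borel S) = sets (restrict_space borel S')"
    by (auto simp: standard_borel_def)
  then have "S = S'"
    using sets_eq_imp_space_eq[of "restrict_space borel S" "restrict_space borel S'"] by (simp add: space_restrict_space)
  with S' show "S \<in> sets borel" by simp
qed (auto simp: standard_borel_def)

text \<open>
  For a Borel set outer measure is measure.  The complement form is the one through which the posterior is
  compared with the prior.
\<close>

lemma full_outer_values_eq:
  assumes \<kappa>: "\<kappa> \<in> borel \<rightarrow>\<^sub>M prob_algebra borel" and S: "S \<in> sets borel"
  shows "full_outer_values \<kappa> S = {v. measure (\<kappa> v) S = 1}" "full_outer_values \<kappa> S = {v. measure (\<kappa> v) (- S) = 0}"
    and "full_outer_values \<kappa> S \<in> sets borel"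
proof -
  have \<kappa>_v: "prob_space (\<kappa> v)" "sets (\<kappa> v) = sets borel" for v
    using measurable_space[OF \<kappa>, of v] by (auto simp: space_prob_algebra)
  show eq: "full_outer_values \<kappa> S = {v. measure (\<kappa> v) S = 1}"
  proof -
    have "outer_measure_of (\<kappa> v) S = 1 \<longleftrightarrow> measure (\<kappa> v) S = 1" for v
    proof -
      interpret prob_space "\<kappa> v" by (rule \<kappa>_v)
      have "S \<in> sets (\<kappa> v)" using S \<kappa>_v(2) by simp
      then show ?thesis by (simp add: emeasure_eq_measure)
    qed
    then show ?thesis by (simp add: full_outer_values_def)
  qed
  have "measure (\<kappa> v) (- S) = 1 - measure (\<kappa> v) S" for v
    using prob_space.prob_compl[OF \<kappa>_v(1), of S v] S \<kappa>_v(2)[of v] sets_eq_imp_space_eq[OF \<kappa>_v(2)[of v]]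
    by (simp add: Compl_eq_Diff_UNIV)
  then show "full_outer_values \<kappa> S = {v. measure (\<kappa> v) (- S) = 0}"
    unfolding eq by auto
  have "(\<lambda>v. measure (\<kappa> v) S) \<in> borel_measurable borel"
    using \<kappa> measurable_measure_prob_algebra[OF S] by (rule measurable_compose)
  then have "(\<lambda>v. measure (\<kappa> v) S) -` {1} \<inter> space borel \<in> sets borel"
    by (rule measurable_sets) simp
  then show "full_outer_values \<kappa> S \<in> sets borel"
    unfolding eq by (simp add: vimage_def)
qed

text \<open>
  By disintegration, the event that \<open>U\<close> misses \<open>S\<close> while the kernel charges only \<open>S\<close> is null.
\<close>

lemma regular_conditional_AE_full:
  assumes M: "prob_space M" and reg: "regular_conditional M borel borel U V \<kappa>" and S: "S \<in> sets borel"
  shows "AE \<omega> in M. V \<omega> \<in> full_outer_values \<kappa> S \<longrightarrow> U \<omega> \<in> S"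
proof -
  define G where "G = full_outer_values \<kappa> S"
  have U: "U \<in> M \<rightarrow>\<^sub>M borel" and V: "V \<in> M \<rightarrow>\<^sub>M borel" and \<kappa>: "\<kappa> \<in> borel \<rightarrow>\<^sub>M prob_algebra borel"
    using reg by (auto simp: regular_conditional_def)
  have S': "- S \<in> sets borel"
    using S by (simp add: borel_comp)
  have G_eq: "G = {v. measure (\<kappa> v) (- S) = 0}" and G [measurable]: "G \<in> sets borel"
    unfolding G_def using full_outer_values_eq[OF \<kappa> S] by auto
  have [measurable]: "U \<in> M \<rightarrow>\<^sub>M borel" "V \<in> M \<rightarrow>\<^sub>M borel" "- S \<in> sets borel"
    by (fact U V S')+
  have "(\<integral>\<^sup>+\<omega>. indicator (- S) (U \<omega>) * indicator G (V \<omega>) \<partial>M)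
      = (\<integral>\<^sup>+\<omega>. (\<integral>\<^sup>+u. indicator (- S) u \<partial>\<kappa> (V \<omega>)) * indicator G (V \<omega>) \<partial>M)"
    by (rule nn_integral_regular_conditional[OF M reg]) auto
  also have "\<dots> = (\<integral>\<^sup>+\<omega>. 0 \<partial>M)"
  proof (rule nn_integral_cong)
    fix \<omega>
    have "prob_space (\<kappa> (V \<omega>))" and sets: "sets (\<kappa> (V \<omega>)) = sets borel"
      using measurable_space[OF \<kappa>, of "V \<omega>"] by (auto simp: space_prob_algebra)
    then interpret prob_space "\<kappa> (V \<omega>)" by simp
    have "(\<integral>\<^sup>+u. indicator (- S) u \<partial>\<kappa> (V \<omega>)) = ennreal (measure (\<kappa> (V \<omega>)) (- S))"
      using S' sets by (simp add: emeasure_eq_measure)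
    then show "(\<integral>\<^sup>+u. indicator (- S) u \<partial>\<kappa> (V \<omega>)) * indicator G (V \<omega>) = 0"
      by (simp add: G_eq split: split_indicator)
  qed
  also have "\<dots> = 0" by simp
  finally have "AE \<omega> in M. indicator (- S) (U \<omega>) * indicator G (V \<omega>) = (0 :: ennreal)"
    by (subst (asm) nn_integral_0_iff_AE) auto
  then show ?thesis
    by (rule AE_mp) (auto simp: G_def indicator_def split: if_splits intro!: AE_I2)
qed

text \<open>
  The posterior mass of the complement of \<open>Tt\<close>, averaged over \<open>{Y \<in> Yt}\<close>, is the probability that \<open>\<Theta>\<close> misses
  \<open>Tt\<close> there, which is zero.  As it is nonnegative, it vanishes almost everywhere on that event.
\<close>

lemma AE_posterior_index_full:
  assumes model: "hierarchical_model M borel borel borel X \<Theta> Y p q"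
    and Tt: "Tt \<in> sets borel"
    and t: "t \<in> sample_space n borel \<Otimes>\<^sub>M borel \<rightarrow>\<^sub>M borel"
    and posterior: "AE \<omega> in M. event_prob_given M (sample_space n borel \<Otimes>\<^sub>M borel) (\<lambda>\<omega>. (sample n X \<omega>, Y \<omega>)) (\<Theta> -` (- Tt)) \<omega>
      = measure (q (t (sample n X \<omega>, Y \<omega>))) (- Tt)"
  shows "AE \<omega> in M. Y \<omega> \<in> full_outer_values q Tt \<longrightarrow> t (sample n X \<omega>, Y \<omega>) \<in> full_outer_values q Tt"
proof -
  define Yt where "Yt = full_outer_values q Tt"
  define V where "V = (\<lambda>\<omega>. (sample n X \<omega>, Y \<omega>))"
  have M: "prob_space M" and X: "\<And>i. X i \<in> M \<rightarrow>\<^sub>M borel" and reg: "regular_conditional M borel borel \<Theta> Y q"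
    and q: "q \<in> borel \<rightarrow>\<^sub>M prob_algebra borel"
    and \<Theta> [measurable]: "\<Theta> \<in> M \<rightarrow>\<^sub>M borel" and Y [measurable]: "Y \<in> M \<rightarrow>\<^sub>M borel"
    using model by (auto simp: hierarchical_model_def regular_conditional_def)
  have mTt [measurable]: "- Tt \<in> sets borel"
    using Tt by (simp add: borel_comp)
  have Yt_eq: "Yt = {y. measure (q y) (- Tt) = 0}" and [measurable]: "Yt \<in> sets borel"
    unfolding Yt_def using full_outer_values_eq[OF q Tt] by auto
  have V [measurable]: "V \<in> M \<rightarrow>\<^sub>M sample_space n borel \<Otimes>\<^sub>M borel"
    unfolding V_def using measurable_sample[of X, OF X] Y by measurable
  have qm: "(\<lambda>y. measure (q y) (- Tt)) \<in> borel_measurable borel"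
    using q measurable_measure_prob_algebra[OF mTt] by (rule measurable_compose)
  note gm [measurable] = measurable_compose[OF t qm]
  have g01: "0 \<le> measure (q y) (- Tt) \<and> measure (q y) (- Tt) \<le> 1" for y
    using measurable_space[OF q, of y] by (auto simp: space_prob_algebra prob_space.prob_le_1)
  have E: "\<Theta> -` (- Tt) \<inter> space M \<in> sets M"
    by (rule measurable_sets[OF \<Theta> mTt])
  have "(\<integral>\<^sup>+\<omega>. ennreal (measure (q (t (V \<omega>))) (- Tt)) * indicator Yt (snd (V \<omega>)) \<partial>M)
      = (\<integral>\<^sup>+\<omega>. indicator (\<Theta> -` (- Tt)) \<omega> * indicator Yt (snd (V \<omega>)) \<partial>M)"
    using posterior g01 by (intro nn_integral_event_prob_given[OF M V E gm, symmetric]) (auto simp: V_def)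
  also have "\<dots> = (\<integral>\<^sup>+\<omega>. indicator (\<Theta> -` (- Tt)) \<omega> * indicator Yt (Y \<omega>) \<partial>M)"
    by (simp add: V_def)
  also have "\<dots> = (\<integral>\<^sup>+\<omega>. 0 \<partial>M)"
    using regular_conditional_AE_full[OF M reg Tt]
    by (intro nn_integral_cong_AE) (auto simp: Yt_def indicator_def)
  also have "\<dots> = 0" by simp
  finally have "AE \<omega> in M. ennreal (measure (q (t (V \<omega>))) (- Tt)) * indicator Yt (snd (V \<omega>)) = 0"
    by (subst (asm) nn_integral_0_iff_AE) (use measurable_compose[OF V gm] in auto)
  then have "AE \<omega> in M. Y \<omega> \<in> Yt \<longrightarrow> t (V \<omega>) \<in> Yt"
    by (rule AE_mp) (auto simp: V_def Yt_eq indicator_def split: if_splits intro!: AE_I2)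
  then show ?thesis
    by (simp add: Yt_def V_def)
qed

section \<open>The restricted model\<close>

locale restricted_bayesian_model =
  fixes M :: "'w measure"
    and X :: "nat \<Rightarrow> 'w \<Rightarrow> 'x::polish_space"
    and \<Theta> :: "'w \<Rightarrow> 't::polish_space"
    and Y :: "'w \<Rightarrow> 'y::polish_space"
    and p :: "'t \<Rightarrow> 'x measure"
    and q :: "'y \<Rightarrow> 't measure"
    and Xt :: "'z measure"
    and J :: "'z \<Rightarrow> 'x"
    and Tt :: "'t set"
    and Yt :: "'y set"
    and \<Omega>t :: "'w set"
    and pt :: "'t \<Rightarrow> 'z measure"
    and qt :: "'y \<Rightarrow> 't measure"
  assumes model: "bayesian_model M borel borel borel X \<Theta> Y p q"
    and J: "borel_embedding Xt borel J"
    and Tt: "Tt = full_outer_values p (J ` space Xt)"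
    and pt: "\<And>\<theta>. \<theta> \<in> Tt \<Longrightarrow> is_pullback (space Xt) J (p \<theta>) (pt \<theta>)"
    and Yt: "Yt = full_outer_values q Tt"
    and qt: "\<And>y. y \<in> Yt \<Longrightarrow> is_pullback Tt (\<lambda>\<theta>. \<theta>) (q y) (qt y)"
    and \<Omega>t: "\<Omega>t = restricted_domain M X \<Theta> Y (J ` space Xt) Tt Yt"
    and \<Omega>t_measurable: "\<Omega>t \<in> sets M"
    and \<Omega>t_non_null: "emeasure M \<Omega>t \<noteq> 0"
begin

abbreviation "Mt \<equiv> conditioned_on M \<Omega>t"
abbreviation "MTt \<equiv> restrict_space borel Tt"
abbreviation "MYt \<equiv> restrict_space borel Yt"
abbreviation "X' \<equiv> (\<lambda>i \<omega>. inv_into (space Xt) J (X i \<omega>))"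

lemma hierarchical: "hierarchical_model M borel borel borel X \<Theta> Y p q"
  using model by (rule bayesian_model_imp_hierarchical_model)

lemma prob_space_M: "prob_space M"
  using model by (simp add: bayesian_model_def)

lemma measurable_X [measurable]: "X i \<in> M \<rightarrow>\<^sub>M borel"
  and measurable_\<Theta> [measurable]: "\<Theta> \<in> M \<rightarrow>\<^sub>M borel"
  and measurable_Y [measurable]: "Y \<in> M \<rightarrow>\<^sub>M borel"
  and kernel_p: "p \<in> borel \<rightarrow>\<^sub>M prob_algebra borel"
  and kernel_q: "q \<in> borel \<rightarrow>\<^sub>M prob_algebra borel"
  using hierarchical by (auto simp: hierarchical_model_def regular_conditional_def)

lemma space_Mt: "space Mt = \<Omega>t"
  using \<Omega>t_measurable by (rule space_conditioned_on)

lemma prob_space_Mt: "prob_space Mt"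
  using prob_space_M \<Omega>t_measurable \<Omega>t_non_null by (rule prob_space_conditioned_on)

lemma AE_Mt: "(AE \<omega> in Mt. P \<omega>) \<longleftrightarrow> (AE \<omega> in M. \<omega> \<in> \<Omega>t \<longrightarrow> P \<omega>)"
  using prob_space_M \<Omega>t_measurable \<Omega>t_non_null by (rule AE_conditioned_on)

lemma \<Omega>tD:
  assumes "\<omega> \<in> \<Omega>t"
  shows "\<omega> \<in> space M" "X i \<omega> \<in> J ` space Xt" "\<Theta> \<omega> \<in> Tt" "Y \<omega> \<in> Yt"
  using assms by (auto simp: \<Omega>t restricted_domain_def)

lemma J_X': "\<omega> \<in> \<Omega>t \<Longrightarrow> J (X' i \<omega>) = X i \<omega>"
  using \<Omega>tD(2) by (rule f_inv_into_f)

lemma measurable_J: "J \<in> Xt \<rightarrow>\<^sub>M borel"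
  and sets_Xt: "sets Xt = sets (vimage_algebra (space Xt) J borel)"
  using sets_borel_embedding[OF J] by auto

lemma sets_MTt: "sets MTt = sets (vimage_algebra (space MTt) (\<lambda>\<theta>. \<theta>) borel)"
  and measurable_MTt: "(\<lambda>\<theta>. \<theta>) \<in> MTt \<rightarrow>\<^sub>M borel"
  and sets_MYt: "sets MYt = sets (vimage_algebra (space MYt) (\<lambda>y. y) borel)"
  and measurable_MYt: "(\<lambda>y. y) \<in> MYt \<rightarrow>\<^sub>M borel"
  by (auto intro!: sets_restrict_space_vimage measurable_restrict_space1)

lemma measurable_X': "X' i \<in> Mt \<rightarrow>\<^sub>M Xt"
proof (rule measurable_vimage_algebra_sets[OF sets_Xt])
  show "X' i \<in> space Mt \<rightarrow> space Xt"
    using \<Omega>tD(2) by (auto simp: space_Mt intro: inv_into_into)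
  show "(\<lambda>\<omega>. J (X' i \<omega>)) \<in> Mt \<rightarrow>\<^sub>M borel"
    by (rule measurable_cong[THEN iffD2, OF _ measurable_conditioned_on[OF measurable_X]])
      (simp add: space_Mt J_X')
qed

lemma measurable_\<Theta>_MTt: "\<Theta> \<in> Mt \<rightarrow>\<^sub>M MTt" and measurable_Y_MYt: "Y \<in> Mt \<rightarrow>\<^sub>M MYt"
  by (rule measurable_restrict_space2; use \<Omega>tD(3,4) in \<open>auto simp: space_Mt intro: measurable_conditioned_on\<close>)+

lemma measure_pt:
  assumes "\<theta> \<in> Tt" "B \<in> sets borel"
  shows "measure (pt \<theta>) (J -` B \<inter> space Xt) = measure (p \<theta>) B"
proof (rule measure_pullback[OF pt])
  show "B \<in> sets (p \<theta>)"
    using assms measurable_space[OF kernel_p, of \<theta>] by (simp add: space_prob_algebra)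
qed fact

lemma measure_qt:
  assumes "y \<in> Yt" "B \<in> sets borel"
  shows "measure (qt y) (B \<inter> Tt) = measure (q y) B"
proof -
  have "B \<in> sets (q y)"
    using assms measurable_space[OF kernel_q, of y] by (simp add: space_prob_algebra)
  then show ?thesis
    using measure_pullback[OF qt[OF assms(1)], of B] by simp
qed

text \<open>
  Read through the inclusions, the restricted model and the original kernels make the same assertion about
  \<open>Mt\<close>.  Both directions matter: from left to right to obtain the posterior, from right to left to establish
  the restricted model.
\<close>

lemma conditionally_iid_Mt_iff:
  "conditionally_iid Mt Xt MTt MYt X' \<Theta> Y pt \<longleftrightarrow> conditionally_iid Mt borel borel borel X \<Theta> Y p"
proof (rule conditionally_iid_pullback_iff[OF prob_space_Mt measurable_X' measurable_\<Theta>_MTt measurable_Y_MYt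
    sets_Xt measurable_J sets_MTt measurable_MTt sets_MYt measurable_MYt])
  show "X i \<omega> = J (X' i \<omega>)" if "\<omega> \<in> space Mt" for i \<omega>
    using that by (simp add: J_X' space_Mt)
  show "measure (pt \<theta>) (J -` S \<inter> space Xt) = measure (p \<theta>) S" if "\<theta> \<in> space MTt" "S \<in> sets borel" for \<theta> S
    using that by (intro measure_pt) (simp_all add: space_restrict_space)
qed (intro measurable_conditioned_on measurable_X)

lemma regular_conditional_Mt_iff:
  assumes "qt \<in> MYt \<rightarrow>\<^sub>M prob_algebra MTt"
  shows "regular_conditional Mt MTt MYt \<Theta> Y qt \<longleftrightarrow> regular_conditional Mt borel borel \<Theta> Y q"
  by (rule regular_conditional_pullback_iff[OF prob_space_Mt measurable_\<Theta>_MTt measurable_Y_MYt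
        sets_MTt measurable_MTt sets_MYt measurable_MYt _ _ _ _ assms kernel_q])
    (auto intro: measurable_conditioned_on simp: space_restrict_space measure_qt)

text \<open>
  The hyperparameter space \<open>MYt\<close> itself serves as the space of index values, with kernel \<open>qt\<close>; the pullback of the
  index takes values there by construction.
\<close>

lemma posterior_index_restricted:
  assumes conj: "conjugate M borel borel borel X \<Theta> Y q T" and y0: "y0 \<in> Yt"
    and restricted: "bayesian_model Mt Xt MTt MYt X' \<Theta> Y pt qt"
  shows "\<forall>n\<ge>1. AE z in distr Mt (sample_space n Xt \<Otimes>\<^sub>M MYt) (\<lambda>\<omega>. (sample n X' \<omega>, Y \<omega>)). embedded_index J T n z \<in> Yt"
    and "conjugate Mt Xt MTt MYt X' \<Theta> Y qt (pullback_index J Yt y0 T)"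
proof -
  have Tt_borel: "Tt \<in> sets borel" and Yt_borel [measurable]: "Yt \<in> sets borel"
    using restricted by (simp_all add: bayesian_model_def standard_borel_restrict_space_iff)
  have kernel_qt: "qt \<in> MYt \<rightarrow>\<^sub>M prob_algebra MTt"
    using restricted by (simp add: bayesian_model_def regular_conditional_def)
  have hierarchical_Mt: "hierarchical_model Mt borel borel borel X \<Theta> Y p q"
    using restricted conditionally_iid_Mt_iff regular_conditional_Mt_iff[OF kernel_qt]
    by (simp add: bayesian_model_def hierarchical_model_def prob_space_Mt measurable_conditioned_on measurable_X kernel_p)
  obtain W k where sets_W: "sets W = sets (restrict_space borel (space W))" and
    index: "posterior_index M borel borel borel X \<Theta> Y W k T" and k: "\<And>w. w \<in> space W \<Longrightarrow> k w = q w"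
    using conj by (auto simp: conjugate_def)
  have T_W: "T n \<in> sample_space n borel \<Otimes>\<^sub>M borel \<rightarrow>\<^sub>M W" if "n \<ge> 1" for n
    using index that by (simp add: posterior_index_def)
  have T: "T n \<in> sample_space n borel \<Otimes>\<^sub>M borel \<rightarrow>\<^sub>M borel" if "n \<ge> 1" for n
  proof -
    have "T n \<in> sample_space n borel \<Otimes>\<^sub>M borel \<rightarrow>\<^sub>M restrict_space borel (space W)"
      using T_W[OF that] measurable_cong_sets[OF refl sets_W] by blast
    then show ?thesis
      by (simp add: measurable_restrict_space2_iff)
  qed
  have posterior: "AE \<omega> in M. event_prob_given M (sample_space n borel \<Otimes>\<^sub>M borel) (\<lambda>\<omega>. (sample n X \<omega>, Y \<omega>)) (\<Theta> -` A) \<omega>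
      = measure (q (T n (sample n X \<omega>, Y \<omega>))) A" if n: "n \<ge> 1" and A: "A \<in> sets borel" for n A
  proof -
    have "AE \<omega> in M. event_prob_given M (sample_space n borel \<Otimes>\<^sub>M borel) (\<lambda>\<omega>. (sample n X \<omega>, Y \<omega>)) (\<Theta> -` A) \<omega>
        = measure (k (T n (sample n X \<omega>, Y \<omega>))) A"
      using index n A by (simp add: posterior_index_def)
    moreover have "k (T n (sample n X \<omega>, Y \<omega>)) = q (T n (sample n X \<omega>, Y \<omega>))" for \<omega>
      by (rule k, rule measurable_space[OF T_W[OF n]]) (auto simp: space_pair_measure space_PiM)
    ultimately show ?thesis by simp
  qed
  have in_Yt: "AE \<omega> in Mt. T n (sample n X \<omega>, Y \<omega>) \<in> Yt" if n: "n \<ge> 1" for n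
  proof -
    have "AE \<omega> in M. Y \<omega> \<in> Yt \<longrightarrow> T n (sample n X \<omega>, Y \<omega>) \<in> Yt"
      unfolding Yt using Tt_borel
      by (intro AE_posterior_index_full[OF hierarchical Tt_borel T[OF n]] posterior n) (simp add: borel_comp)
    then show ?thesis
      unfolding AE_Mt using \<Omega>tD(4) by (auto elim!: AE_mp)
  qed
  have embedded: "embedded_index J T n (sample n X' \<omega>, Y \<omega>) = T n (sample n X \<omega>, Y \<omega>)" if "\<omega> \<in> \<Omega>t" for n \<omega>
  proof -
    have "(\<lambda>i\<in>{..<n}. J (sample n X' \<omega> i)) = sample n X \<omega>"
      using J_X'[OF that] by (auto simp: restrict_def)
    then show ?thesis
      by (simp add: embedded_index_def)
  qed
  have embedded_measurable [measurable]: "embedded_index J T n \<in> sample_space n Xt \<Otimes>\<^sub>M MYt \<rightarrow>\<^sub>M borel" if n: "n \<ge> 1" for n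
  proof -
    have "(\<lambda>z. (\<lambda>i\<in>{..<n}. J (fst z i), snd z)) \<in> sample_space n Xt \<Otimes>\<^sub>M MYt \<rightarrow>\<^sub>M sample_space n borel \<Otimes>\<^sub>M borel"
      using measurable_compose[OF measurable_fst measurable_sample_map[OF measurable_J]]
        measurable_compose[OF measurable_snd measurable_MYt] by (intro measurable_Pair)
    from measurable_compose[OF this T[OF n]] show ?thesis
      by (simp add: embedded_index_def case_prod_beta)
  qed
  have data: "(\<lambda>\<omega>. (sample n X' \<omega>, Y \<omega>)) \<in> Mt \<rightarrow>\<^sub>M sample_space n Xt \<Otimes>\<^sub>M MYt" for n
    using measurable_sample[of X', OF measurable_X'] measurable_Y_MYt by (intro measurable_Pair)
  show "\<forall>n\<ge>1. AE z in distr Mt (sample_space n Xt \<Otimes>\<^sub>M MYt) (\<lambda>\<omega>. (sample n X' \<omega>, Y \<omega>)). embedded_index J T n z \<in> Yt"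
  proof (intro allI impI)
    fix n :: nat assume n: "n \<ge> 1"
    have "{z \<in> space (sample_space n Xt \<Otimes>\<^sub>M MYt). embedded_index J T n z \<in> Yt} \<in> sets (sample_space n Xt \<Otimes>\<^sub>M MYt)"
      using measurable_sets[OF embedded_measurable[OF n] Yt_borel] by (simp add: vimage_def Int_def conj_commute)
    from AE_distr_iff[OF data this]
    show "AE z in distr Mt (sample_space n Xt \<Otimes>\<^sub>M MYt) (\<lambda>\<omega>. (sample n X' \<omega>, Y \<omega>)). embedded_index J T n z \<in> Yt"
      using in_Yt[OF n] AE_space[of Mt] by (auto simp: space_Mt embedded elim!: AE_mp)
  qed
  have pullback_measurable: "pullback_index J Yt y0 T n \<in> sample_space n Xt \<Otimes>\<^sub>M MYt \<rightarrow>\<^sub>M MYt" if n: "n \<ge> 1" for n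
  proof (rule measurable_restrict_space2)
    show "pullback_index J Yt y0 T n \<in> space (sample_space n Xt \<Otimes>\<^sub>M MYt) \<rightarrow> Yt"
      using y0 by (auto simp: pullback_index_def)
    note [measurable] = embedded_measurable[OF n]
    show "pullback_index J Yt y0 T n \<in> sample_space n Xt \<Otimes>\<^sub>M MYt \<rightarrow>\<^sub>M borel"
      unfolding pullback_index_def[abs_def] by measurable
  qed
  have posterior_Mt: "AE \<omega> in Mt. event_prob_given Mt (sample_space n Xt \<Otimes>\<^sub>M MYt) (\<lambda>\<omega>. (sample n X' \<omega>, Y \<omega>)) (\<Theta> -` A) \<omega>
      = measure (qt (pullback_index J Yt y0 T n (sample n X' \<omega>, Y \<omega>))) A" if n: "n \<ge> 1" and A: "A \<in> sets MTt" for n A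
  proof -
    have A': "A \<in> sets borel" "A \<subseteq> Tt"
      using A Tt_borel by (simp_all add: sets_restrict_space_iff)
    have qA: "(\<lambda>y. measure (q y) A) \<in> borel_measurable borel"
      using kernel_q measurable_measure_prob_algebra[OF A'(1)] by (rule measurable_compose)
    have "0 \<le> measure (q y) A \<and> measure (q y) A \<le> 1" for y
      using measurable_space[OF kernel_q, of y] by (auto simp: space_prob_algebra prob_space.prob_le_1)
    then have "AE \<omega> in Mt. event_prob_given Mt (sample_space n borel \<Otimes>\<^sub>M borel) (\<lambda>\<omega>. (sample n X \<omega>, Y \<omega>)) (\<Theta> -` A) \<omega>
        = measure (q (T n (sample n X \<omega>, Y \<omega>))) A"
      by (intro posterior_determined_by_kernels[OF hierarchical hierarchical_Mt
            absolutely_continuous_distr_conditioned_on[OF \<Omega>t_measurable measurable_Y] A'(1)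
            measurable_compose[OF T[OF n] qA]] posterior[OF n A'(1)])
    moreover have "event_prob_given Mt (sample_space n Xt \<Otimes>\<^sub>M MYt) (\<lambda>\<omega>. (sample n X' \<omega>, Y \<omega>)) (\<Theta> -` A)
        = event_prob_given Mt (sample_space n borel \<Otimes>\<^sub>M borel) (\<lambda>\<omega>. (sample n X \<omega>, Y \<omega>)) (\<Theta> -` A)"
      by (rule event_prob_given_sample_pullback[OF measurable_X' measurable_Y_MYt sets_Xt measurable_J sets_MYt measurable_MYt])
        (simp add: space_Mt J_X')
    moreover have "measure (qt y) A = measure (q y) A" if "y \<in> Yt" for y
      using measure_qt[OF that A'(1)] A'(2) by (simp add: Int_absorb2)
    ultimately show ?thesis
      using in_Yt[OF n] AE_space[of Mt] by (auto simp: space_Mt embedded pullback_index_def elim!: AE_mp)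
  qed
  have "sets MYt = sets (restrict_space MYt (space MYt))"
    using sets.sets_into_space[of _ MYt] by (auto simp: sets_restrict_space_iff)
  moreover have "posterior_index Mt Xt MTt MYt X' \<Theta> Y MYt qt (pullback_index J Yt y0 T)"
    unfolding posterior_index_def
    using restricted kernel_qt pullback_measurable posterior_Mt by (simp add: bayesian_model_def)
  ultimately show "conjugate Mt Xt MTt MYt X' \<Theta> Y qt (pullback_index J Yt y0 T)"
    unfolding conjugate_def by blast
qed

end

section \<open>Restriction to a Borel set of observations\<close>

text \<open>
  Each set of the pulled-back sigma-algebra is a preimage, so its mass is a mass under the original kernel.
\<close>

lemma pullback_kernel_measurable:
  assumes \<kappa>: "\<kappa> \<in> N \<rightarrow>\<^sub>M prob_algebra A"
    and A': "sets A' = sets (vimage_algebra (space A') j A)"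
    and pull: "\<And>v. v \<in> space N \<Longrightarrow> is_pullback (space A') j (\<kappa> v) (\<kappa>' v)"
  shows "\<kappa>' \<in> N \<rightarrow>\<^sub>M prob_algebra A'"
proof -
  have \<kappa>_v: "prob_space (\<kappa> v)" "sets (\<kappa> v) = sets A" if "v \<in> space N" for v
    using measurable_space[OF \<kappa> that] by (auto simp: space_prob_algebra)
  have sets: "sets (\<kappa>' v) = sets A'" if v: "v \<in> space N" for v
  proof -
    have "sets (\<kappa>' v) = sets (vimage_algebra (space A') j (\<kappa> v))"
      using pull[OF v] by (simp add: is_pullback_def)
    also have "\<dots> = sets (vimage_algebra (space A') j A)"
      using \<kappa>_v(2)[OF v] by (rule sets_vimage_algebra_cong)
    finally show ?thesis using A' by simp
  qed
  have emeasure: "emeasure (\<kappa>' v) (j -` B \<inter> space A') = emeasure (\<kappa> v) B" and j: "j \<in> space A' \<rightarrow> space A"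
    if v: "v \<in> space N" and B: "B \<in> sets A" for v B
  proof -
    have distr: "distr (\<kappa>' v) (\<kappa> v) j = \<kappa> v" and sub: "j ` space A' \<subseteq> space (\<kappa> v)"
      using pull[OF v] by (auto simp: is_pullback_def)
    show j: "j \<in> space A' \<rightarrow> space A"
      using sub sets_eq_imp_space_eq[OF \<kappa>_v(2)[OF v]] by auto
    have "j \<in> vimage_algebra (space A') j A \<rightarrow>\<^sub>M A"
      using j by (rule measurable_vimage_algebra1)
    then have "j \<in> \<kappa>' v \<rightarrow>\<^sub>M \<kappa> v"
      using measurable_cong_sets[OF trans[OF sets[OF v] A'] \<kappa>_v(2)[OF v]] by blast
    then have "emeasure (distr (\<kappa>' v) (\<kappa> v) j) B = emeasure (\<kappa>' v) (j -` B \<inter> space (\<kappa>' v))"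
      using B \<kappa>_v(2)[OF v] by (simp add: emeasure_distr)
    then show "emeasure (\<kappa>' v) (j -` B \<inter> space A') = emeasure (\<kappa> v) B"
      using sets_eq_imp_space_eq[OF sets[OF v]] by (simp add: distr)
  qed
  have ex: "\<exists>B\<in>sets A. B' = j -` B \<inter> space A'" if v: "v \<in> space N" and "B' \<in> sets A'" for v B'
  proof -
    have "sets A' = {j -` B \<inter> space A' | B. B \<in> sets A}"
      by (rule trans[OF A' sets_vimage_algebra2]) (rule j[OF v sets.top])
    with that show ?thesis by blast
  qed
  show ?thesis
  proof (rule measurable_prob_algebra_generated)
    show "sets A' = sigma_sets (space A') (sets A')"
      by (simp add: sets.sigma_sets_eq)
    show "Int_stable (sets A')" by (auto simp: Int_stable_def)
    show "sets A' \<subseteq> Pow (space A')" by (rule sets.space_closed)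
  next
    fix v assume v: "v \<in> space N"
    show "sets (\<kappa>' v) = sets A'" using v by (rule sets)
    have "j -` space A \<inter> space A' = space (\<kappa>' v)"
      using j[OF v sets.top] sets_eq_imp_space_eq[OF sets[OF v]] by auto
    then show "prob_space (\<kappa>' v)"
      using emeasure[OF v sets.top] prob_space.emeasure_space_1[OF \<kappa>_v(1)[OF v]] sets_eq_imp_space_eq[OF \<kappa>_v(2)[OF v]]
      by (intro prob_spaceI) simp
  next
    fix B' assume B': "B' \<in> sets A'"
    show "(\<lambda>v. emeasure (\<kappa>' v) B') \<in> borel_measurable N"
    proof (cases "space N = {}")
      case False
      then obtain B where B: "B \<in> sets A" "B' = j -` B \<inter> space A'"
        using ex B' by blast
      have "(\<lambda>v. emeasure (\<kappa> v) B) \<in> borel_measurable N"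
        using measurable_emeasure_kernel[OF measurable_prob_algebraD[OF \<kappa>] B(1)] .
      then show ?thesis
        by (rule measurable_cong[THEN iffD2, rotated]) (simp add: B emeasure)
    qed (simp add: measurable_def)
  qed
qed

context restricted_bayesian_model
begin

context
  assumes S_borel: "J ` space Xt \<in> sets borel"
begin

lemma Tt_borel: "Tt \<in> sets borel"
  unfolding Tt using kernel_p S_borel by (rule full_outer_values_eq)

lemma Yt_borel: "Yt \<in> sets borel"
  unfolding Yt using kernel_q Tt_borel by (rule full_outer_values_eq)

text \<open>
  The hyperparameter condition implies the others almost surely: \<open>Y \<in> Yt\<close> forces \<open>\<Theta> \<in> Tt\<close>, which forces each
  observation into the image of \<open>J\<close>.
\<close>

lemma \<Omega>t_AE_eq: "AE \<omega> in M. \<omega> \<in> \<Omega>t \<longleftrightarrow> Y \<omega> \<in> Yt"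
proof -
  have "AE \<omega> in M. Y \<omega> \<in> Yt \<longrightarrow> \<Theta> \<omega> \<in> Tt"
    unfolding Yt using model Tt_borel by (intro regular_conditional_AE_full prob_space_M) (simp_all add: bayesian_model_def)
  moreover have "AE \<omega> in M. \<Theta> \<omega> \<in> Tt \<longrightarrow> X i \<omega> \<in> J ` space Xt" for i
    unfolding Tt using model S_borel by (intro regular_conditional_AE_full prob_space_M) (simp_all add: bayesian_model_def)
  then have "AE \<omega> in M. \<forall>i. \<Theta> \<omega> \<in> Tt \<longrightarrow> X i \<omega> \<in> J ` space Xt"
    unfolding AE_all_countable by blast
  ultimately show ?thesis
    using AE_space[of M] by eventually_elim (auto simp: \<Omega>t restricted_domain_def)
qed

text \<open>
  Up to a null set \<open>\<Omega>t\<close> is the event \<open>(\<Theta>, Y) \<in> UNIV \<times> Yt\<close>.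
\<close>

lemma conditionally_iid_restricted: "conditionally_iid Mt Xt MTt MYt X' \<Theta> Y pt"
  unfolding conditionally_iid_Mt_iff
  unfolding conditionally_iid_def
proof (intro allI impI)
  fix n :: nat and B :: "nat \<Rightarrow> 'x set" assume B: "\<forall>i<n. B i \<in> sets borel"
  let ?g = "\<lambda>v. \<Prod>i<n. measure (p (fst v)) (B i)"
  have "AE \<omega> in Mt. event_prob_given Mt (borel \<Otimes>\<^sub>M borel) (\<lambda>\<omega>. (\<Theta> \<omega>, Y \<omega>)) {\<omega>. \<forall>i<n. X i \<omega> \<in> B i} \<omega> = ?g (\<Theta> \<omega>, Y \<omega>)"
  proof (rule AE_event_prob_given_conditioned_on[OF prob_space_M \<Omega>t_measurable \<Omega>t_non_null])
    show "(\<lambda>\<omega>. (\<Theta> \<omega>, Y \<omega>)) \<in> M \<rightarrow>\<^sub>M borel \<Otimes>\<^sub>M borel" by measurable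
    show "{\<omega>. \<forall>i<n. X i \<omega> \<in> B i} \<inter> space M \<in> sets M"
      using B by (intro sets_sample_event[OF measurable_X]) auto
    show "UNIV \<times> Yt \<in> sets (borel \<Otimes>\<^sub>M borel)"
      using Yt_borel by (intro pair_measureI) auto
    show "AE \<omega> in M. \<omega> \<in> \<Omega>t \<longleftrightarrow> (\<Theta> \<omega>, Y \<omega>) \<in> UNIV \<times> Yt"
      using \<Omega>t_AE_eq by simp
    show "?g \<in> borel_measurable (borel \<Otimes>\<^sub>M borel)"
      by (rule measurable_compose[OF measurable_fst measurable_prod_measure_kernel[OF kernel_p]]) (use B in auto)
    show "0 \<le> ?g v \<and> ?g v \<le> 1" if "v \<in> space (borel \<Otimes>\<^sub>M borel)" for v
      by (rule prod_measure_kernel_bounds[OF kernel_p]) simp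
    show "AE \<omega> in M. event_prob_given M (borel \<Otimes>\<^sub>M borel) (\<lambda>\<omega>. (\<Theta> \<omega>, Y \<omega>)) {\<omega>. \<forall>i<n. X i \<omega> \<in> B i} \<omega> = ?g (\<Theta> \<omega>, Y \<omega>)"
      using model B unfolding bayesian_model_def conditionally_iid_def by simp
  qed
  then show "AE \<omega> in Mt. event_prob_given Mt (borel \<Otimes>\<^sub>M borel) (\<lambda>\<omega>. (\<Theta> \<omega>, Y \<omega>)) {\<omega>. \<forall>i<n. X i \<omega> \<in> B i} \<omega>
      = (\<Prod>i<n. measure (p (\<Theta> \<omega>)) (B i))"
    by simp
qed

lemma regular_conditional_restricted: "regular_conditional Mt MTt MYt \<Theta> Y qt"
proof -
  have qt_kernel: "qt \<in> MYt \<rightarrow>\<^sub>M prob_algebra MTt"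
  proof (rule pullback_kernel_measurable[OF measurable_restrict_space1[OF kernel_q] sets_MTt])
    show "is_pullback (space MTt) (\<lambda>\<theta>. \<theta>) (q y) (qt y)" if "y \<in> space MYt" for y
      using qt that by (simp add: space_restrict_space)
  qed
  have "AE \<omega> in Mt. event_prob_given Mt borel Y (\<Theta> -` A) \<omega> = measure (q (Y \<omega>)) A" if A: "A \<in> sets borel" for A
  proof (rule AE_event_prob_given_conditioned_on[OF prob_space_M \<Omega>t_measurable \<Omega>t_non_null measurable_Y _ Yt_borel \<Omega>t_AE_eq])
    show "\<Theta> -` A \<inter> space M \<in> sets M"
      using measurable_\<Theta> A by (rule measurable_sets)
    show "(\<lambda>y. measure (q y) A) \<in> borel_measurable borel"
      using kernel_q measurable_measure_prob_algebra[OF A] by (rule measurable_compose)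
    show "0 \<le> measure (q y) A \<and> measure (q y) A \<le> 1" for y
      using measurable_space[OF kernel_q, of y] by (auto simp: space_prob_algebra prob_space.prob_le_1)
    show "AE \<omega> in M. event_prob_given M borel Y (\<Theta> -` A) \<omega> = measure (q (Y \<omega>)) A"
      using model A by (simp add: bayesian_model_def regular_conditional_def)
  qed
  then have "regular_conditional Mt borel borel \<Theta> Y q"
    unfolding regular_conditional_def using kernel_q by (simp add: measurable_conditioned_on)
  then show ?thesis
    using regular_conditional_Mt_iff[OF qt_kernel] by blast
qed

lemma hierarchical_restricted: "hierarchical_model Mt Xt MTt MYt X' \<Theta> Y pt qt"
proof -
  have "pt \<in> MTt \<rightarrow>\<^sub>M prob_algebra Xt"
  proof (rule pullback_kernel_measurable[OF measurable_restrict_space1[OF kernel_p] sets_Xt])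
    show "is_pullback (space Xt) J (p \<theta>) (pt \<theta>)" if "\<theta> \<in> space MTt" for \<theta>
      using pt that by (simp add: space_restrict_space)
  qed
  then show ?thesis
    using prob_space_Mt measurable_X' regular_conditional_restricted conditionally_iid_restricted
    by (simp add: hierarchical_model_def)
qed

text \<open>
  On a Borel image the embedding has a measurable left inverse \<open>g\<close>, defined everywhere by a default value.  Then
  \<open>push\<close> along \<open>J\<close> and \<open>pull\<close> along \<open>g\<close> are measurable between all probability measures, and mutually inverse
  between those on the restricted space and those concentrated on the image.  The restricted limit is
  \<open>pull\<close> of the original limit, and the restricted parameter map is \<open>\<Psi>\<close> after \<open>push\<close>.
\<close>

lemma limiting_empirical_restricted:
  "\<exists>F \<Psi>. limiting_empirical Mt Xt X' F \<and> bimeasurable (prob_algebra Xt) MTt \<Psi> \<and>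
     (AE \<omega> in Mt. \<Theta> \<omega> = \<Psi> (F (\<lambda>i. X' i \<omega>)))"
proof -
  define S where "S = J ` space Xt"
  have [measurable]: "S \<in> sets borel"
    using S_borel by (simp add: S_def)
  obtain F \<Psi> where "limiting_empirical M borel X F" and "bimeasurable (prob_algebra borel) borel \<Psi>"
    and \<Theta>_eq: "AE \<omega> in M. \<Theta> \<omega> = \<Psi> (F (\<lambda>i. X i \<omega>))"
    using model unfolding bayesian_model_def by blast
  then have F: "F \<in> PiM UNIV (\<lambda>_. borel) \<rightarrow>\<^sub>M prob_algebra borel"
    and lim: "\<And>B. B \<in> sets borel \<Longrightarrow> AE \<omega> in M. (\<lambda>n. (\<Sum>i<n. indicator B (X i \<omega>)) / real n) \<longlonglongrightarrow> measure (F (\<lambda>i. X i \<omega>)) B"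
    and \<Psi>: "\<Psi> \<in> prob_algebra borel \<rightarrow>\<^sub>M borel" and \<Psi>_image: "\<And>E. E \<in> sets (prob_algebra borel) \<Longrightarrow> \<Psi> ` E \<in> sets borel"
    unfolding limiting_empirical_def bimeasurable_def by blast+
  have "\<Omega>t \<noteq> {}"
    using \<Omega>t_non_null by auto
  then obtain \<omega>0 where \<omega>0: "\<omega>0 \<in> \<Omega>t" by auto
  define z0 where "z0 = X' 0 \<omega>0"
  define \<theta>0 where "\<theta>0 = \<Theta> \<omega>0"
  have z0: "z0 \<in> space Xt"
    using \<Omega>tD(2)[OF \<omega>0, of 0] by (auto simp: z0_def intro: inv_into_into)
  have \<theta>0: "\<theta>0 \<in> Tt"
    using \<Omega>tD(3)[OF \<omega>0] by (simp add: \<theta>0_def)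
  define g where "g x = (if x \<in> S then inv_into (space Xt) J x else z0)" for x
  have inj: "inj_on J (space Xt)" and inv: "inv_into (space Xt) J \<in> restrict_space borel S \<rightarrow>\<^sub>M Xt"
    using J by (auto simp: borel_embedding_def S_def)
  have g: "g \<in> borel \<rightarrow>\<^sub>M Xt"
    unfolding g_def[abs_def] using inv z0 measurable_restrict_space_iff[of S borel z0 Xt "inv_into (space Xt) J"]
    by simp
  have g_J: "g (J z) = z" if "z \<in> space Xt" for z
    using that inj by (auto simp: g_def S_def)
  have J_g: "J (g x) = x" if "x \<in> S" for x
    using that by (auto simp: g_def S_def f_inv_into_f)
  define push where "push \<nu> = distr \<nu> borel J" for \<nu>
  define pull where "pull \<mu> = distr \<mu> Xt g" for \<mu>
  have push: "push \<in> prob_algebra Xt \<rightarrow>\<^sub>M prob_algebra borel"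
    unfolding push_def[abs_def] using measurable_J by (rule measurable_distr_prob_space)
  have pull: "pull \<in> prob_algebra borel \<rightarrow>\<^sub>M prob_algebra Xt"
    unfolding pull_def[abs_def] using g by (rule measurable_distr_prob_space)
  define full where "full = {\<mu> \<in> space (prob_algebra (borel :: 'x measure)). measure \<mu> S = 1}"
  have full: "full \<in> sets (prob_algebra borel)"
    unfolding full_def using measurable_measure_prob_algebra[of S borel] by measurable
  have pull_push: "pull (push \<nu>) = \<nu>" if "\<nu> \<in> space (prob_algebra Xt)" for \<nu>
  proof -
    have sets: "sets \<nu> = sets Xt" using that by (simp add: space_prob_algebra)
    have J\<nu>: "J \<in> \<nu> \<rightarrow>\<^sub>M borel"
      using measurable_J measurable_cong_sets[OF sets refl] by blast
    have "pull (push \<nu>) = distr \<nu> Xt (g \<circ> J)"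
      unfolding pull_def push_def using g J\<nu> by (rule distr_distr)
    also have "\<dots> = distr \<nu> \<nu> (\<lambda>z. z)"
      using sets g_J sets_eq_imp_space_eq[OF sets] by (intro distr_cong) auto
    finally show ?thesis by (simp add: distr_id)
  qed
  have push_full: "push \<nu> \<in> full" if "\<nu> \<in> space (prob_algebra Xt)" for \<nu>
  proof -
    have \<nu>: "prob_space \<nu>" "sets \<nu> = sets Xt" using that by (simp_all add: space_prob_algebra)
    have J\<nu>: "J \<in> \<nu> \<rightarrow>\<^sub>M borel"
      using measurable_J measurable_cong_sets[OF \<nu>(2) refl] by blast
    have "J -` S \<inter> space \<nu> = space \<nu>"
      using sets_eq_imp_space_eq[OF \<nu>(2)] by (auto simp: S_def)
    then have "measure (push \<nu>) S = 1"
      unfolding push_def using J\<nu> prob_space.prob_space[OF \<nu>(1)] by (simp add: measure_distr)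
    then show ?thesis
      using measurable_space[OF push that] by (simp add: full_def)
  qed
  have push_pull: "push (pull \<mu>) = \<mu>" if \<mu>_full: "\<mu> \<in> full" for \<mu>
  proof -
    have \<mu>: "prob_space \<mu>" "sets \<mu> = sets borel" and one: "measure \<mu> S = 1"
      using \<mu>_full by (auto simp: full_def space_prob_algebra)
    interpret prob_space \<mu> by fact
    have "AE x in \<mu>. x \<in> S"
      using one \<mu>(2) by (intro AE_prob_1) auto
    then have ae: "AE x in \<mu>. (J \<circ> g) x = x"
      by (rule AE_mp) (simp add: J_g)
    have g\<mu>: "g \<in> \<mu> \<rightarrow>\<^sub>M Xt"
      using g measurable_cong_sets[OF \<mu>(2) refl] by blast
    have "push (pull \<mu>) = distr \<mu> borel (J \<circ> g)"
      unfolding pull_def push_def using measurable_J g\<mu> by (rule distr_distr)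
    also have "\<dots> = distr \<mu> borel (\<lambda>x. x)"
      using ae measurable_comp[OF g\<mu> measurable_J] \<mu>(2)
      by (intro distr_cong_AE) (auto cong: measurable_cong_sets)
    also have "\<dots> = distr \<mu> \<mu> (\<lambda>x. x)"
      using \<mu>(2) by (intro distr_cong) auto
    finally show ?thesis by (simp add: distr_id)
  qed
  define F' where "F' z = pull (F (\<lambda>i. J (z i)))" for z
  \<comment> \<open>The default value keeps \<open>\<Psi>'\<close> inside \<open>Tt\<close>; it adds at most one point to the image of a set.\<close>
  define \<Psi>' where "\<Psi>' \<nu> = (if \<Psi> (push \<nu>) \<in> Tt then \<Psi> (push \<nu>) else \<theta>0)" for \<nu>
  have F_X': "F' (\<lambda>i. X' i \<omega>) = pull (F (\<lambda>i. X i \<omega>))" if "\<omega> \<in> \<Omega>t" for \<omega>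
    using J_X'[OF that] by (simp add: F'_def)
  have F_space: "F x \<in> space (prob_algebra borel)" for x
    by (rule measurable_space[OF F]) (simp add: space_PiM)
  \<comment> \<open>The empirical frequency of the image of \<open>J\<close> is constantly 1 on \<open>\<Omega>t\<close>, hence so is its limit.\<close>
  have F_full: "AE \<omega> in M. \<omega> \<in> \<Omega>t \<longrightarrow> F (\<lambda>i. X i \<omega>) \<in> full"
    using lim[OF \<open>S \<in> sets borel\<close>]
  proof eventually_elim
    fix \<omega> assume lim: "(\<lambda>n. (\<Sum>i<n. indicator S (X i \<omega>)) / real n) \<longlonglongrightarrow> measure (F (\<lambda>i. X i \<omega>)) S"
    show "\<omega> \<in> \<Omega>t \<longrightarrow> F (\<lambda>i. X i \<omega>) \<in> full"
    proof
      assume "\<omega> \<in> \<Omega>t"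
      then have in_S: "X i \<omega> \<in> S" for i
        using \<Omega>tD(2) by (simp add: S_def)
      have "\<forall>\<^sub>F n in sequentially. (\<Sum>i<n. indicator S (X i \<omega>)) / real n = 1"
        using eventually_gt_at_top[of 0] by eventually_elim (simp add: in_S)
      then have "(\<lambda>n. (\<Sum>i<n. indicator S (X i \<omega>)) / real n) \<longlonglongrightarrow> 1"
        by (rule tendsto_eventually)
      with lim have "measure (F (\<lambda>i. X i \<omega>)) S = 1"
        by (rule LIMSEQ_unique)
      then show "F (\<lambda>i. X i \<omega>) \<in> full"
        using F_space by (simp add: full_def)
    qed
  qed
  have "limiting_empirical Mt Xt X' F'"
    unfolding limiting_empirical_def
  proof (intro conjI ballI)
    have "(\<lambda>z i. J (z i)) \<in> PiM UNIV (\<lambda>_. Xt) \<rightarrow>\<^sub>M PiM UNIV (\<lambda>_. borel)"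
    proof (rule measurable_PiM_single')
      show "(\<lambda>z. J (z i)) \<in> PiM UNIV (\<lambda>_. Xt) \<rightarrow>\<^sub>M borel" for i
        using measurable_compose[OF measurable_component_singleton[of i UNIV "\<lambda>_. Xt"] measurable_J] by simp
    qed (auto simp: space_PiM)
    then show "F' \<in> PiM UNIV (\<lambda>_. Xt) \<rightarrow>\<^sub>M prob_algebra Xt"
      unfolding F'_def[abs_def] by (rule measurable_compose[OF measurable_compose[OF _ F] pull])
  next
    fix B' assume "B' \<in> sets Xt"
    moreover have "sets Xt = {J -` B \<inter> space Xt | B. B \<in> sets borel}"
      by (rule trans[OF sets_Xt sets_vimage_algebra2]) simp
    ultimately obtain B where B: "B \<in> sets borel" and B': "B' = J -` B \<inter> space Xt"
      by blast
    have ind: "indicator B' (X' i \<omega>) = (indicator B (X i \<omega>) :: real)" if "\<omega> \<in> \<Omega>t" for i \<omega>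
      using J_X'[OF that, of i] \<Omega>tD(2)[OF that, of i] by (auto simp: B' indicator_def intro: inv_into_into)
    have measure_pull: "measure (pull \<mu>) B' = measure \<mu> B" if "\<mu> \<in> full" for \<mu>
    proof -
      have "sets (pull \<mu>) = sets Xt" by (simp add: pull_def)
      then have "J \<in> pull \<mu> \<rightarrow>\<^sub>M borel"
        using measurable_J measurable_cong_sets by blast
      then have "measure (push (pull \<mu>)) B = measure (pull \<mu>) B'"
        unfolding push_def B' using B by (simp add: measure_distr) (simp add: pull_def)
      then show ?thesis using push_pull[OF that] by simp
    qed
    show "AE \<omega> in Mt. (\<lambda>n. (\<Sum>i<n. indicator B' (X' i \<omega>)) / real n) \<longlonglongrightarrow> measure (F' (\<lambda>i. X' i \<omega>)) B'"
      unfolding AE_Mt using lim[OF B] F_full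
      by eventually_elim (auto simp: F_X' measure_pull ind)
  qed
  moreover have "bimeasurable (prob_algebra Xt) MTt \<Psi>'"
    unfolding bimeasurable_def
  proof (intro conjI ballI)
    note [measurable] = measurable_compose[OF push \<Psi>] Tt_borel
    have "\<Psi>' \<in> prob_algebra Xt \<rightarrow>\<^sub>M borel"
      unfolding \<Psi>'_def[abs_def] by measurable
    then show "\<Psi>' \<in> prob_algebra Xt \<rightarrow>\<^sub>M MTt"
      using \<theta>0 by (intro measurable_restrict_space2) (auto simp: \<Psi>'_def)
  next
    fix E assume E: "E \<in> sets (prob_algebra Xt)"
    \<comment> \<open>As \<open>push\<close> has the measurable inverse \<open>pull\<close>, its images are preimages.\<close>
    have "push ` E = full \<inter> (pull -` E \<inter> space (prob_algebra borel))"
    proof (intro set_eqI iffI)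
      fix \<mu> assume "\<mu> \<in> push ` E"
      then show "\<mu> \<in> full \<inter> (pull -` E \<inter> space (prob_algebra borel))"
        using sets.sets_into_space[OF E] push_full pull_push measurable_space[OF push] by auto
    next
      fix \<mu> assume "\<mu> \<in> full \<inter> (pull -` E \<inter> space (prob_algebra borel))"
      then show "\<mu> \<in> push ` E"
        using push_pull[of \<mu>] by (auto intro!: image_eqI[of _ _ "pull \<mu>"])
    qed
    then have push_E: "push ` E \<in> sets (prob_algebra borel)"
      using full measurable_sets[OF pull E] by simp
    have "\<Psi>' ` E = (\<Psi> ` push ` E \<inter> Tt) \<union> (if \<exists>\<nu>\<in>E. \<Psi> (push \<nu>) \<notin> Tt then {\<theta>0} else {})"
      by (auto simp: \<Psi>'_def image_iff)
    also have "\<dots> \<in> sets borel"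
      using \<Psi>_image[OF push_E] Tt_borel by auto
    finally show "\<Psi>' ` E \<in> sets MTt"
      using \<theta>0 Tt_borel by (auto simp: sets_restrict_space_iff \<Psi>'_def)
  qed
  moreover have "AE \<omega> in Mt. \<Theta> \<omega> = \<Psi>' (F' (\<lambda>i. X' i \<omega>))"
    unfolding AE_Mt using \<Theta>_eq F_full
  proof eventually_elim
    fix \<omega> assume "\<Theta> \<omega> = \<Psi> (F (\<lambda>i. X i \<omega>))" and "\<omega> \<in> \<Omega>t \<longrightarrow> F (\<lambda>i. X i \<omega>) \<in> full"
    then show "\<omega> \<in> \<Omega>t \<longrightarrow> \<Theta> \<omega> = \<Psi>' (F' (\<lambda>i. X' i \<omega>))"
      using \<Omega>tD(3)[of \<omega>] by (auto simp: F_X' \<Psi>'_def push_pull)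
  qed
  ultimately show ?thesis by blast
qed

lemma bayesian_model_restricted: "bayesian_model Mt Xt MTt MYt X' \<Theta> Y pt qt"
  unfolding bayesian_model_def
  using prob_space_Mt Tt_borel Yt_borel hierarchical_restricted limiting_empirical_restricted
    hierarchical_model_regular_conditional[OF hierarchical_restricted]
    hierarchical_model_exchangeable[OF hierarchical_restricted]
    conditionally_iid_restricted regular_conditional_restricted
  by (simp add: standard_borel_restrict_space_iff)

end

end

theorem proposition4:
  fixes M :: "'w measure"
    and X :: "nat \<Rightarrow> 'w \<Rightarrow> 'x::polish_space"
    and \<Theta> :: "'w \<Rightarrow> 't::polish_space"
    and Y :: "'w \<Rightarrow> 'y::polish_space"
    and p :: "'t \<Rightarrow> 'x measure"
    and q :: "'y \<Rightarrow> 't measure"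
    and T :: "nat \<Rightarrow> (nat \<Rightarrow> 'x) \<times> 'y \<Rightarrow> 'y"
    and Xt :: "'z measure"
    and J :: "'z \<Rightarrow> 'x"
    and Tt :: "'t set"
    and Yt :: "'y set"
    and \<Omega>t :: "'w set"
    and pt :: "'t \<Rightarrow> 'z measure"
    and qt :: "'y \<Rightarrow> 't measure"
    and y0 :: 'y
  assumes model: "bayesian_model M borel borel borel X \<Theta> Y p q"
    and conj: "conjugate M borel borel borel X \<Theta> Y q T"
    and J: "borel_embedding Xt borel J"
    and Tt: "Tt = full_outer_values p (J ` space Xt)"
    and pt: "\<And>\<theta>. \<theta> \<in> Tt \<Longrightarrow> is_pullback (space Xt) J (p \<theta>) (pt \<theta>)"
    and Yt: "Yt = full_outer_values q Tt"
    and qt: "\<And>y. y \<in> Yt \<Longrightarrow> is_pullback Tt (\<lambda>\<theta>. \<theta>) (q y) (qt y)"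
    and \<Omega>t: "\<Omega>t = restricted_domain M X \<Theta> Y (J ` space Xt) Tt Yt"
    and \<Omega>t_measurable: "\<Omega>t \<in> sets M"
    and \<Omega>t_non_null: "emeasure M \<Omega>t \<noteq> 0"
    and y0: "y0 \<in> Yt"
  defines "Mt \<equiv> conditioned_on M \<Omega>t"
    and "MTt \<equiv> restrict_space borel Tt"
    and "MYt \<equiv> restrict_space borel Yt"
    and "X' \<equiv> (\<lambda>i \<omega>. inv_into (space Xt) J (X i \<omega>))"
  shows "(J ` space Xt \<in> sets borel \<longrightarrow> bayesian_model Mt Xt MTt MYt X' \<Theta> Y pt qt) \<and>
         (bayesian_model Mt Xt MTt MYt X' \<Theta> Y pt qt \<longrightarrow>
            (\<forall>n\<ge>1. AE z in distr Mt (sample_space n Xt \<Otimes>\<^sub>M MYt) (\<lambda>\<omega>. (sample n X' \<omega>, Y \<omega>)).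
                      embedded_index J T n z \<in> Yt) \<and>
            conjugate Mt Xt MTt MYt X' \<Theta> Y qt (pullback_index J Yt y0 T))"
proof -
  interpret restricted_bayesian_model M X \<Theta> Y p q Xt J Tt Yt \<Omega>t pt qt
    using model J Tt pt Yt qt \<Omega>t \<Omega>t_measurable \<Omega>t_non_null by unfold_locales
  show ?thesis
    unfolding Mt_def MTt_def MYt_def X'_def
    using bayesian_model_restricted posterior_index_restricted[OF conj y0] by blast
qed

end
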